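(* Let $\mu,\nu\in\mathcal P_1(\mathbb R)$ be such that $\mu\le_{cx}\nu$ and $\mu\neq\nu$, and let $\pi\in\Pi(\mu,\nu)$ satisfy the barycentre dispersion assumption $$\forall a\in\mathbb R,\quad\int_{\mathbb R}\mathbf 1_{[a,+\infty)}(x)\Big(x-\int_{\mathbb R}y\,\pi_x(dy)\Big)\,\mu(dx)\le0.$$ Let $(m_u)_{u\in(0,1)}$ be the probability kernel constructed from $\pi$ in the context and let $\widehat M(du,dx,dy)=\lambda_{(0,1)}(du)\,\delta_{F_\mu^{-1}(u)}(dx)\,m_u(dy)$. Then $\widehat M$ is a lifted martingale rearrangement coupling of the lifted coupling $\widehat\pi=\iota(\pi)$; more precisely, $\widehat M\in\widehat\Pi^{\mathrm M}(\mu,\nu)$ and $$\inf_{\widehat M'\in\widehat\Pi^{\mathrm M}(\mu,\nu)}\widehat{\mathcal{AW}}_1(\widehat\pi,\widehat M')=\widehat{\mathcal{AW}}_1(\widehat\pi,\widehat M)=\int_{(0,1)}\mathcal W_1(\pi_{F_\mu^{-1}(u)},m_u)\,du=\int_{(0,1)}\left|G(u)-F_\mu^{-1}(u)\right|\,du,$$ where $G(u)=\int_{\mathbb R}y\,\pi_{F_\mu^{-1}(u)}(dy)$.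
   Context: **General notation.** $\mathcal P_\rho(\mathbb R)$ is the set of probability measures on $\mathbb R$ with finite moment of order $\rho\ge1$. $\Pi(\mu,\nu)$ is the set of couplings of $\mu$ and $\nu$; for $\pi\in\Pi(\mu,\nu)$, $(\pi_x)_{x\in\mathbb R}$ denotes its disintegration $\pi(dx,dy)=\mu(dx)\,\pi_x(dy)$ (a version with $\pi_x\in\mathcal P_1(\mathbb R)$ for all $x$ is used). $\mu\le_{cx}\nu$ (convex order) means $\int f\,d\mu\le\int f\,d\nu$ for all convex $f:\mathbb R\to\mathbb R$. $F_\eta(x)=\eta((-\infty,x])$, $F_\eta^{-1}(u)=\inf\{x\in\mathbb R: F_\eta(x)\ge u\}$ for $u\in(0,1)$. $\eta\le_{st}\eta'$ (stochastic order) means $F_\eta^{-1}(u)\le F_{\eta'}^{-1}(u)$ for all $u\in(0,1)$. $\mathcal W_\rho$ is the Wasserstein distance of order $\rho$ on $\mathcal P_\rho(\mathbb R)$ for the cost $|x-y|^\rho$. $\lambda_{(0,1)}$ is the Lebesgue measure on $(0,1)$. **Lifted couplings.** $\widehat\Pi(\mu,\nu)$ is the set of measures on $(0,1)\times\mathbb R\times\mathbb R$ of the form $\widehat\pi(du,dx,dy)=\lambda_{(0,1)}(du)\,\delta_{F_\mu^{-1}(u)}(dx)\,p_u(dy)$, with $(p_u)_{u\in(0,1)}$ a probability kernel, whose third marginal is $\nu$ (the second one is automatically $\mu$). $\widehat\Pi^{\mathrm M}(\mu,\nu)$ is the subset of those with $\int_{\mathbb R}y\,p_u(dy)=F_\mu^{-1}(u)$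 for $du$-almost all $u\in(0,1)$. The embedding $\iota:\Pi(\mu,\nu)\to\widehat\Pi(\mu,\nu)$ is $\iota(\pi)=\lambda_{(0,1)}(du)\,\delta_{F_\mu^{-1}(u)}(dx)\,\pi_{F_\mu^{-1}(u)}(dy)$. For $\widehat\pi=\lambda_{(0,1)}\times\delta_{F_\mu^{-1}(u)}\times p_u\in\widehat\Pi(\mu,\nu)$ and $\widehat\pi'=\lambda_{(0,1)}\times\delta_{F_{\mu'}^{-1}(u)}\times p'_u\in\widehat\Pi(\mu',\nu')$, $$\widehat{\mathcal{AW}}_\rho(\widehat\pi,\widehat\pi')=\inf_{\chi\in\Pi(\lambda_{(0,1)},\lambda_{(0,1)})}\left(\int_{(0,1)^2}\left(|u-u'|^\rho+|F_\mu^{-1}(u)-F_{\mu'}^{-1}(u')|^\rho+\mathcal W_\rho^\rho(p_u,p'_{u'})\right)\chi(du,du')\right)^{1/\rho}.$$ $\widehat M\in\widehat\Pi^{\mathrm M}(\mu,\nu)$ is a lifted martingale rearrangement coupling of $\widehat\pi\in\widehat\Pi(\mu,\nu)$ if $\widehat{\mathcal{AW}}_1(\widehat\pi,\widehat M)=\inf_{\widehat M'\in\widehat\Pi^{\mathrm M}(\mu,\nu)}\widehat{\mathcal{AW}}_1(\widehat\pi,\widehat M')$. **The maps $\beta,\widetilde\beta$.** Let $\mathfrak B$ be the set of quadruples $(y,\widetilde y,\eta,\widetilde\eta)\in\mathbb R\times\mathbb R\times\mathcal P_1(\mathbb R)\times\mathcal P_1(\mathbb R)$ such that the means $x,\widetilde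 x$ of $\eta,\widetilde\eta$ satisfy $x<y\le\widetilde y<\widetilde x$, with the trace of the product $\sigma$-algebra ($\mathcal P_1(\mathbb R)$ carrying the Borel $\sigma$-algebra of weak convergence). Fix measurable maps $\beta,\widetilde\beta:\mathfrak B\to\mathcal P_1(\mathbb R)$ (such maps exist) such that for all $(y,\widetilde y,\eta,\widetilde\eta)\in\mathfrak B$, setting $\zeta=\beta(y,\widetilde y,\eta,\widetilde\eta)$, $\widetilde\zeta=\widetilde\beta(y,\widetilde y,\eta,\widetilde\eta)$ and $q=\frac{\widetilde x-\widetilde y}{y-x+\widetilde x-\widetilde y}$: $\zeta$ has mean $y$, $\widetilde\zeta$ has mean $\widetilde y$, $\eta\le_{st}\zeta$, $\widetilde\zeta\le_{st}\widetilde\eta$ and $q\zeta+(1-q)\widetilde\zeta=q\eta+(1-q)\widetilde\eta$. **Construction of $(m_u)$.** For $\pi$ as in the claim, let $G(u)=\int_{\mathbb R}y\,\pi_{F_\mu^{-1}(u)}(dy)$, $\Delta_+(u)=\int_0^u(F_\mu^{-1}-G)^+(v)\,dv$ and $\Delta_-(u)=\int_0^u(F_\mu^{-1}-G)^-(v)\,dv$ for $u\in[0,1]$ (positive and negative parts); one has $\Delta_+(1)=\Delta_-(1)$. Let $\Delta_\pm^{-1}$ be the left-continuous generalised inverses, $\Delta_\pm^{-1}(w)=\inf\{r\in[0,1]:\Delta_\pm(r)\ge w\}$. Let $\mathcal U^+=\{u\in(0,1): F_\mu^{-1}(u)>G(u)\}$, $\mathcal U^-=\{u\in(0,1): F_\mu^{-1}(u)<G(u)\}$,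 $\mathcal U^0=\{u\in(0,1): F_\mu^{-1}(u)=G(u)\}$, and $$\phi(u)=\Delta_-^{-1}(\Delta_+(u))\text{ if }u\in\mathcal U^+,\quad\phi(u)=\Delta_+^{-1}(\Delta_-(u))\text{ if }u\in\mathcal U^-,\quad\phi(u)=u\text{ if }u\in\mathcal U^0.$$ For $du$-almost all $u\in\mathcal U^+$ (resp. $\mathcal U^-$) one has $\phi(u)\in\mathcal U^-$ (resp. $\mathcal U^+$), and for such $u$ set $p(u)=\frac{G(\phi(u))-F_\mu^{-1}(\phi(u))}{F_\mu^{-1}(u)-G(u)+G(\phi(u))-F_\mu^{-1}(\phi(u))}$. Let $$A^+=\{u\in\mathcal U^+:\ F_\mu^{-1}(\phi(u))<G(\phi(u)),\ \phi(\phi(u))=u,\ p(\phi(u))=1-p(u)\},$$ $$A^-=\{u\in\mathcal U^-:\ F_\mu^{-1}(\phi(u))>G(\phi(u)),\ \phi(\phi(u))=u,\ p(\phi(u))=1-p(u)\}.$$ Then $\phi(A^+)=A^-$, $\phi(A^-)=A^+$ and $G(u)<F_\mu^{-1}(u)\le F_\mu^{-1}(\phi(u))<G(\phi(u))$ for $u\in A^+$. Define - for $u\in A^+$: $m_u=\beta\big(F_\mu^{-1}(u),F_\mu^{-1}(\phi(u)),\pi_{F_\mu^{-1}(u)},\pi_{F_\mu^{-1}(\phi(u))}\big)$; - for $u\in A^-$: $m_u=\widetilde\beta\big(F_\mu^{-1}(\phi(u)),F_\mu^{-1}(u),\pi_{F_\mu^{-1}(\phi(u))},\pi_{F_\mu^{-1}(u)}\big)$;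 - for all other $u\in(0,1)$: $m_u=\pi_{F_\mu^{-1}(u)}$. *)

theory Defs
  imports "HOL-Probability.Probability"
begin

section \<open>Probability measures on the real line\<close>

definition P1 :: "real measure set" where
  "P1 = {\<eta>. prob_space \<eta> \<and> sets \<eta> = sets borel \<and> integrable \<eta> (\<lambda>y. y)}"

definition mean :: "real measure \<Rightarrow> real" where
  "mean \<eta> = (\<integral>y. y \<partial>\<eta>)"

definition quantile :: "real measure \<Rightarrow> real \<Rightarrow> real" where
  "quantile \<eta> u = Inf {x. u \<le> cdf \<eta> x}"

definition st_le :: "real measure \<Rightarrow> real measure \<Rightarrow> bool" where
  "st_le \<eta> \<eta>' \<longleftrightarrow> (\<forall>u\<in>{0<..<1}. quantile \<eta> u \<le> quantile \<eta>' u)"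

text \<open>
  A convex function is bounded below by an affine one, so its integral against an element of
  \<^const>\<open>P1\<close> exists in \<open>(-\<infinity>, \<infinity>]\<close>. The Bochner integral would return 0 instead of \<open>\<infinity>\<close>, hence the
  extended-real integral.
\<close>

definition ext_integral :: "'a measure \<Rightarrow> ('a \<Rightarrow> real) \<Rightarrow> ereal" where
  "ext_integral M f =
     enn2ereal (\<integral>\<^sup>+x. ennreal (f x) \<partial>M) - enn2ereal (\<integral>\<^sup>+x. ennreal (- f x) \<partial>M)"

definition cx_le :: "real measure \<Rightarrow> real measure \<Rightarrow> bool" where
  "cx_le \<mu> \<nu> \<longleftrightarrow> (\<forall>f. convex_on UNIV f \<longrightarrow> ext_integral \<mu> f \<le> ext_integral \<nu> f)"

definition couplings :: "'a measure \<Rightarrow> 'b measure \<Rightarrow> ('a \<times> 'b) measure set" where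
  "couplings M N =
     {\<gamma>. sets \<gamma> = sets (M \<Otimes>\<^sub>M N) \<and> distr \<gamma> M fst = M \<and> distr \<gamma> N snd = N}"

text \<open>The transport costs are \<open>[0, \<infinity>]\<close>-valued; only the order 1 is needed, so no root is taken.\<close>

definition W1 :: "real measure \<Rightarrow> real measure \<Rightarrow> ennreal" where
  "W1 \<eta> \<eta>' = (INF \<gamma>\<in>couplings \<eta> \<eta>'. \<integral>\<^sup>+(y, y'). ennreal \<bar>y - y'\<bar> \<partial>\<gamma>)"

definition disintegration :: "real measure \<Rightarrow> (real \<times> real) measure \<Rightarrow> (real \<Rightarrow> real measure) \<Rightarrow> bool" where
  "disintegration \<mu> \<pi> \<kappa> \<longleftrightarrow>
     \<kappa> \<in> borel \<rightarrow>\<^sub>M prob_algebra borel \<and> (\<forall>x. \<kappa> x \<in> P1) \<and>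
     \<pi> = \<mu> \<bind> (\<lambda>x. \<kappa> x \<bind> (\<lambda>y. return (borel \<Otimes>\<^sub>M borel) (x, y)))"

definition barycentre_dispersion :: "real measure \<Rightarrow> (real \<Rightarrow> real measure) \<Rightarrow> bool" where
  "barycentre_dispersion \<mu> \<kappa> \<longleftrightarrow>
     (\<forall>a. (\<integral>x. indicator {a..} x * (x - mean (\<kappa> x)) \<partial>\<mu>) \<le> 0)"


section \<open>Lifted couplings\<close>

definition lam01 :: "real measure" where
  "lam01 = restrict_space lborel {0<..<1}"

definition lift :: "real measure \<Rightarrow> (real \<Rightarrow> real measure) \<Rightarrow> (real \<times> real \<times> real) measure" where
  "lift \<mu> p = lam01 \<bind> (\<lambda>u. p u \<bind>
     (\<lambda>y. return (lam01 \<Otimes>\<^sub>M borel \<Otimes>\<^sub>M borel) (u, quantile \<mu> u, y)))"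

definition lifted_couplings :: "real measure \<Rightarrow> real measure \<Rightarrow> (real \<times> real \<times> real) measure set" where
  "lifted_couplings \<mu> \<nu> =
     {lift \<mu> p | p. p \<in> lam01 \<rightarrow>\<^sub>M prob_algebra borel \<and>
        distr (lift \<mu> p) borel (\<lambda>(u, x, y). y) = \<nu>}"

definition lifted_martingale_couplings ::
    "real measure \<Rightarrow> real measure \<Rightarrow> (real \<times> real \<times> real) measure set" where
  "lifted_martingale_couplings \<mu> \<nu> =
     {lift \<mu> p | p. p \<in> lam01 \<rightarrow>\<^sub>M prob_algebra borel \<and>
        distr (lift \<mu> p) borel (\<lambda>(u, x, y). y) = \<nu> \<and>
        (AE u in lam01. integrable (p u) (\<lambda>y. y) \<and> mean (p u) = quantile \<mu> u)}"

text \<open>The embedding \<open>\<iota>\<close>, evaluated at the coupling \<open>\<mu>(dx) \<kappa>\<^sub>x(dy)\<close>.\<close>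

definition iota :: "real measure \<Rightarrow> (real \<Rightarrow> real measure) \<Rightarrow> (real \<times> real \<times> real) measure" where
  "iota \<mu> \<kappa> = lift \<mu> (\<lambda>u. \<kappa> (quantile \<mu> u))"

text \<open>
  The kernel \<open>p\<close> of a lifted coupling is determined up to a Lebesgue-null set of \<open>u\<close>. As the
  marginals of \<open>\<theta>\<close> below are Lebesgue, the value of \<open>AW1\<close> does not depend on the choice.
\<close>

definition lifted_kernel :: "real measure \<Rightarrow> (real \<times> real \<times> real) measure \<Rightarrow> real \<Rightarrow> real measure" where
  "lifted_kernel \<mu> \<gamma> = (SOME p. p \<in> lam01 \<rightarrow>\<^sub>M prob_algebra borel \<and> \<gamma> = lift \<mu> p)"

definition AW1 :: "real measure \<Rightarrow> real measure \<Rightarrow>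
    (real \<times> real \<times> real) measure \<Rightarrow> (real \<times> real \<times> real) measure \<Rightarrow> ennreal" where
  "AW1 \<mu> \<mu>' \<gamma> \<gamma>' =
     (INF \<theta>\<in>couplings lam01 lam01.
        \<integral>\<^sup>+(u, u'). ennreal \<bar>u - u'\<bar> + ennreal \<bar>quantile \<mu> u - quantile \<mu>' u'\<bar>
            + W1 (lifted_kernel \<mu> \<gamma> u) (lifted_kernel \<mu>' \<gamma>' u') \<partial>\<theta>)"

definition lifted_martingale_rearrangement :: "real measure \<Rightarrow> real measure \<Rightarrow>
    (real \<times> real \<times> real) measure \<Rightarrow> (real \<times> real \<times> real) measure \<Rightarrow> bool" where
  "lifted_martingale_rearrangement \<mu> \<nu> \<gamma> M \<longleftrightarrow>
     \<gamma> \<in> lifted_couplings \<mu> \<nu> \<and> M \<in> lifted_martingale_couplings \<mu> \<nu> \<and>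
     AW1 \<mu> \<mu> \<gamma> M = (INF M'\<in>lifted_martingale_couplings \<mu> \<nu>. AW1 \<mu> \<mu> \<gamma> M')"


section \<open>The maps \<open>\<beta>\<close> and \<open>\<beta>'\<close>\<close>

definition P1_weak_topology :: "real measure topology" where
  "P1_weak_topology = topology_generated_by
     {{\<eta>\<in>P1. (\<integral>y. f y \<partial>\<eta>) \<in> V} | (f :: real \<Rightarrow> real) V.
        continuous_on UNIV f \<and> bounded (range f) \<and> open V}"

definition P1_borel :: "real measure measure" where
  "P1_borel = sigma P1 {V. openin P1_weak_topology V}"

definition frakB :: "(real \<times> real \<times> real measure \<times> real measure) set" where
  "frakB = {(y, y', \<eta>, \<eta>'). \<eta> \<in> P1 \<and> \<eta>' \<in> P1 \<and> mean \<eta> < y \<and> y \<le> y' \<and> y' < mean \<eta>'}"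

definition frakB_algebra :: "(real \<times> real \<times> real measure \<times> real measure) measure" where
  "frakB_algebra =
     restrict_space (borel \<Otimes>\<^sub>M borel \<Otimes>\<^sub>M P1_borel \<Otimes>\<^sub>M P1_borel) frakB"

definition beta_maps ::
    "(real \<times> real \<times> real measure \<times> real measure \<Rightarrow> real measure) \<Rightarrow>
     (real \<times> real \<times> real measure \<times> real measure \<Rightarrow> real measure) \<Rightarrow> bool" where
  "beta_maps \<beta> \<beta>' \<longleftrightarrow>
     \<beta> \<in> frakB_algebra \<rightarrow>\<^sub>M P1_borel \<and> \<beta>' \<in> frakB_algebra \<rightarrow>\<^sub>M P1_borel \<and>
     (\<forall>(y, y', \<eta>, \<eta>')\<in>frakB.
        let \<zeta> = \<beta> (y, y', \<eta>, \<eta>'); \<zeta>' = \<beta>' (y, y', \<eta>, \<eta>');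
            q = (mean \<eta>' - y') / (y - mean \<eta> + mean \<eta>' - y')
        in mean \<zeta> = y \<and> mean \<zeta>' = y' \<and> st_le \<eta> \<zeta> \<and> st_le \<zeta>' \<eta>' \<and>
           (\<forall>A\<in>sets borel. q * measure \<zeta> A + (1 - q) * measure \<zeta>' A
                          = q * measure \<eta> A + (1 - q) * measure \<eta>' A))"


section \<open>The rearranged kernel\<close>

context
  fixes \<mu> :: "real measure" and \<kappa> :: "real \<Rightarrow> real measure"
begin

definition bary :: "real \<Rightarrow> real" where
  "bary u = mean (\<kappa> (quantile \<mu> u))"

definition Delta_plus :: "real \<Rightarrow> real" where
  "Delta_plus u = (LBINT v:{0<..<u}. max 0 (quantile \<mu> v - bary v))"

definition Delta_minus :: "real \<Rightarrow> real" where
  "Delta_minus u = (LBINT v:{0<..<u}. max 0 (- (quantile \<mu> v - bary v)))"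

definition gen_inv :: "(real \<Rightarrow> real) \<Rightarrow> real \<Rightarrow> real" where
  "gen_inv \<Delta> w = Inf {r\<in>{0..1}. \<Delta> r \<ge> w}"

definition U_plus :: "real set" where
  "U_plus = {u\<in>{0<..<1}. quantile \<mu> u > bary u}"

definition U_minus :: "real set" where
  "U_minus = {u\<in>{0<..<1}. quantile \<mu> u < bary u}"

definition phi :: "real \<Rightarrow> real" where
  "phi u = (if u \<in> U_plus then gen_inv Delta_minus (Delta_plus u)
            else if u \<in> U_minus then gen_inv Delta_plus (Delta_minus u)
            else u)"

definition pp :: "real \<Rightarrow> real" where
  "pp u = (bary (phi u) - quantile \<mu> (phi u)) /
          (quantile \<mu> u - bary u + bary (phi u) - quantile \<mu> (phi u))"

text \<open>
  \<open>phi u\<close> ranges over \<open>[0, 1]\<close> whereas \<^const>\<open>quantile\<close> is meaningful on \<open>(0, 1)\<close> only, so the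
  inequality between \<open>quantile \<mu> (phi u)\<close> and \<open>bary (phi u)\<close> is stated as membership
  of \<open>phi u\<close> in \<open>U_minus\<close> resp. \<open>U_plus\<close>.
\<close>

definition A_plus :: "real set" where
  "A_plus = {u\<in>U_plus. phi u \<in> U_minus \<and> phi (phi u) = u \<and> pp (phi u) = 1 - pp u}"

definition A_minus :: "real set" where
  "A_minus = {u\<in>U_minus. phi u \<in> U_plus \<and> phi (phi u) = u \<and> pp (phi u) = 1 - pp u}"

definition m_kernel ::
    "(real \<times> real \<times> real measure \<times> real measure \<Rightarrow> real measure) \<Rightarrow>
     (real \<times> real \<times> real measure \<times> real measure \<Rightarrow> real measure) \<Rightarrow> real \<Rightarrow> real measure" where
  "m_kernel \<beta> \<beta>' u =
     (if u \<in> A_plus then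
        \<beta> (quantile \<mu> u, quantile \<mu> (phi u), \<kappa> (quantile \<mu> u), \<kappa> (quantile \<mu> (phi u)))
      else if u \<in> A_minus then
        \<beta>' (quantile \<mu> (phi u), quantile \<mu> u, \<kappa> (quantile \<mu> (phi u)), \<kappa> (quantile \<mu> u))
      else \<kappa> (quantile \<mu> u))"

end

end

theory Submission
  imports Defs
begin

text \<open>
  Write \<open>Q\<close> for the quantile function of \<open>\<mu>\<close>, \<open>k\<^sub>u = \<kappa> (Q u)\<close> for the given kernel and \<open>G u\<close> for the
  mean of \<open>k\<^sub>u\<close>. Every quantity in the claim equals the total barycentre defect \<open>\<integral>\<bar>G - Q\<bar>\<close>.

  No lifted martingale coupling is closer than that: if \<open>p\<close> is its kernel, \<open>W1 k\<^sub>u p\<^sub>v\<close> is at least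
  the difference \<open>\<bar>G u - Q v\<bar>\<close> of the means, and together with the term \<open>\<bar>Q u - Q v\<bar>\<close> of the cost
  this dominates \<open>\<bar>G u - Q u\<bar>\<close>, whatever the coupling of the parameters \<open>u\<close> and \<open>v\<close>
  (\<open>AW1_ge_barycentre_defect\<close>).

  The kernel \<open>m\<close> attains the bound with the diagonal coupling of the parameters
  (\<open>AW1_le_diagonal\<close>): almost every \<open>m\<^sub>u\<close> has mean \<open>Q u\<close> and is stochastically comparable with
  \<open>k\<^sub>u\<close>, so the quantile coupling of the two costs exactly \<open>\<bar>G u - Q u\<bar>\<close> (\<open>W1_eq_mean_diff\<close>).

  It remains to see that \<open>m\<close> is the kernel of a lifted coupling with third marginal \<open>\<nu>\<close>. The map
  \<open>\<phi>\<close> is the monotone rearrangement between the measures on \<open>(0,1)\<close> with densities \<open>(Q - G)\<^sup>+\<close> and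
  \<open>(Q - G)\<^sup>-\<close>, which have the same total mass because \<open>\<mu>\<close> and \<open>\<nu>\<close> have the same mean. It
  transports each measure to the other and is an involution almost everywhere
  (\<open>distr_monotone_rearrangement\<close>, \<open>AE_density_rearrangement\<close>); hence almost every point with
  \<open>Q \<noteq> G\<close> is matched, that is, lies in \<open>A_plus\<close> or \<open>A_minus\<close>. At a matched pair \<open>u\<close>, \<open>\<phi> u\<close> the
  mixture identity for \<open>\<beta>\<close> and \<open>\<beta>'\<close> says that \<open>m - k\<close>, divided by \<open>\<bar>Q - G\<bar>\<close>, takes opposite values,
  and the change of variables \<open>\<phi>\<close> makes the total change of mass vanish
  (\<open>integral_mass_change\<close>).

  The dispersion assumption enters through \<open>Delta_minus \<le> Delta_plus\<close>
  (\<open>Delta_minus_le_Delta_plus\<close>). It forces \<open>u \<le> \<phi> u\<close> on \<open>A_plus\<close>, hence \<open>Q u \<le> Q (\<phi> u)\<close>, so that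
  the matched data lie in the domain of \<open>\<beta>\<close> and \<open>\<beta>'\<close>. Finally, these maps are measurable for the
  Borel algebra of the weak topology, whereas kernels are measurable for the Giry algebra. Passing
  between the two rests on every weakly open set being a countable union of Giry measurable sets
  (\<open>measurable_prob_algebra_imp_P1_borel\<close>, \<open>measurable_P1_borel_imp_prob_algebra\<close>).
\<close>

section \<open>Quantile couplings and the Wasserstein distance\<close>

lemma P1_D:
  assumes "\<eta> \<in> P1"
  shows "prob_space \<eta>" "sets \<eta> = sets borel" "space \<eta> = UNIV" "integrable \<eta> (\<lambda>y. y)"
  using assms sets_eq_imp_space_eq[of \<eta> borel] by (auto simp: P1_def)

lemma cdf_distribution_P1:
  assumes "\<eta> \<in> P1"
  shows "cdf_distribution \<eta>"
  using P1_D[OF assms]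
  by (simp add: cdf_distribution_def real_distribution_def real_distribution_axioms_def)

lemma space_lam01 [simp]: "space lam01 = {0<..<1}"
  by (simp add: lam01_def space_restrict_space)

lemma sets_lam01: "sets lam01 = sets (restrict_space borel {0<..<1})"
  by (auto simp: lam01_def sets_restrict_space)

lemma prob_space_lam01: "prob_space lam01"
  by (auto simp: lam01_def emeasure_restrict_space space_restrict_space intro!: prob_spaceI)

interpretation lam01: prob_space lam01
  by (rule prob_space_lam01)

lemma measurable_ident_lam01: "(\<lambda>u. u) \<in> borel_measurable lam01"
  unfolding measurable_cong_sets[OF sets_lam01 refl] by (rule measurable_restrict_space1) simp

lemma measurable_quantile:
  assumes "\<eta> \<in> P1"
  shows "quantile \<eta> \<in> borel_measurable lam01"
  using cdf_distribution.measurable_CI[OF cdf_distribution_P1[OF assms]]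
  by (simp add: measurable_cong_sets[OF sets_lam01 refl] quantile_def[abs_def])

lemma mono_on_quantile:
  assumes "\<eta> \<in> P1"
  shows "mono_on {0<..<1} (quantile \<eta>)"
proof -
  interpret cdf_distribution \<eta> by (rule cdf_distribution_P1[OF assms])
  show ?thesis using mono_I by (simp add: quantile_def[abs_def])
qed

lemma distr_quantile:
  assumes "\<eta> \<in> P1"
  shows "distr lam01 borel (quantile \<eta>) = \<eta>"
  using cdf_distribution.distr_I_eq_M[OF cdf_distribution_P1[OF assms]]
  by (simp add: lam01_def quantile_def[abs_def])

lemma integrable_quantile:
  assumes "\<eta> \<in> P1"
  shows "integrable lam01 (quantile \<eta>)"
  using integrable_distr[OF measurable_quantile[OF assms], of "\<lambda>y. y"] P1_D(4)[OF assms]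
  unfolding distr_quantile[OF assms] by blast

lemma integral_quantile:
  assumes "\<eta> \<in> P1"
  shows "(\<integral>u. quantile \<eta> u \<partial>lam01) = mean \<eta>"
  using integral_distr[OF measurable_quantile[OF assms], of "\<lambda>y. y"]
  unfolding distr_quantile[OF assms] mean_def by simp

lemma couplings_D:
  assumes "\<gamma> \<in> couplings M N"
  shows "fst \<in> \<gamma> \<rightarrow>\<^sub>M M" "snd \<in> \<gamma> \<rightarrow>\<^sub>M N" "distr \<gamma> M fst = M" "distr \<gamma> N snd = N"
    and "sets \<gamma> = sets (M \<Otimes>\<^sub>M N)"
proof -
  show s: "sets \<gamma> = sets (M \<Otimes>\<^sub>M N)" and "distr \<gamma> M fst = M" "distr \<gamma> N snd = N"
    using assms by (auto simp: couplings_def)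
  show "fst \<in> \<gamma> \<rightarrow>\<^sub>M M" "snd \<in> \<gamma> \<rightarrow>\<^sub>M N"
    unfolding measurable_cong_sets[OF s refl] by measurable
qed

text \<open>
  The expectation of \<open>Y - Y'\<close> is the same for all couplings \<open>(Y, Y')\<close>, so Jensen's inequality for
  the absolute value bounds every transport cost below.
\<close>

lemma W1_ge_mean_diff:
  assumes "\<eta> \<in> P1" "\<eta>' \<in> P1"
  shows "ennreal \<bar>mean \<eta> - mean \<eta>'\<bar> \<le> W1 \<eta> \<eta>'"
  unfolding W1_def
proof (rule INF_greatest)
  fix \<gamma> assume "\<gamma> \<in> couplings \<eta> \<eta>'"
  note c = couplings_D[OF this]
  have m: "fst \<in> borel_measurable \<gamma>" "snd \<in> borel_measurable \<gamma>"
    using c(1,2) by (simp_all add: measurable_cong_sets[OF refl P1_D(2)[OF assms(1)]]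
      measurable_cong_sets[OF refl P1_D(2)[OF assms(2)]])
  have i: "integrable \<gamma> (fst :: real \<times> real \<Rightarrow> real)" "integrable \<gamma> (snd :: real \<times> real \<Rightarrow> real)"
    using P1_D(4)[OF assms(1)] P1_D(4)[OF assms(2)]
      integrable_distr[OF c(1), of "\<lambda>y. y"] integrable_distr[OF c(2), of "\<lambda>y. y"]
    by (simp_all add: c(3,4))
  have "mean \<eta> = (\<integral>z. fst z \<partial>\<gamma>)"
    using integral_distr[OF c(1), of "\<lambda>y. y"] P1_D(2)[OF assms(1)]
    by (simp add: c(3) mean_def measurable_ident_sets)
  moreover have "mean \<eta>' = (\<integral>z. snd z \<partial>\<gamma>)"
    using integral_distr[OF c(2), of "\<lambda>y. y"] P1_D(2)[OF assms(2)]
    by (simp add: c(4) mean_def measurable_ident_sets)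
  ultimately have "mean \<eta> - mean \<eta>' = (\<integral>z. fst z - snd z \<partial>\<gamma>)"
    using i by simp
  then have "\<bar>mean \<eta> - mean \<eta>'\<bar> \<le> (\<integral>z. \<bar>fst z - snd z\<bar> \<partial>\<gamma>)"
    by (simp add: integral_abs_bound)
  moreover have "(\<integral>\<^sup>+z. ennreal \<bar>fst z - snd z\<bar> \<partial>\<gamma>) = ennreal (\<integral>z. \<bar>fst z - snd z\<bar> \<partial>\<gamma>)"
    using i by (intro nn_integral_eq_integral) auto
  ultimately show "ennreal \<bar>mean \<eta> - mean \<eta>'\<bar> \<le> (\<integral>\<^sup>+(y, y'). ennreal \<bar>y - y'\<bar> \<partial>\<gamma>)"
    by (simp add: case_prod_beta' ennreal_leI)
qed

lemma W1_le_quantile_cost: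
  assumes "\<eta> \<in> P1" "\<eta>' \<in> P1"
  shows "W1 \<eta> \<eta>' \<le> (\<integral>\<^sup>+u. ennreal \<bar>quantile \<eta> u - quantile \<eta>' u\<bar> \<partial>lam01)"
proof -
  let ?T = "\<lambda>u. (quantile \<eta> u, quantile \<eta>' u)"
  let ?\<gamma> = "distr lam01 (\<eta> \<Otimes>\<^sub>M \<eta>') ?T"
  have [measurable]: "quantile \<eta> \<in> lam01 \<rightarrow>\<^sub>M \<eta>" "quantile \<eta>' \<in> lam01 \<rightarrow>\<^sub>M \<eta>'"
    using measurable_quantile[OF assms(1)] measurable_quantile[OF assms(2)]
    by (simp_all add: measurable_cong_sets[OF refl P1_D(2)[OF assms(1)]]
      measurable_cong_sets[OF refl P1_D(2)[OF assms(2)]])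
  have [measurable]: "(\<lambda>y. y) \<in> borel_measurable \<eta>" "(\<lambda>y. y) \<in> borel_measurable \<eta>'"
    using P1_D(2)[OF assms(1)] P1_D(2)[OF assms(2)] by (simp_all add: measurable_ident_sets)
  have "distr ?\<gamma> \<eta> fst = distr lam01 borel (quantile \<eta>)"
    by (subst distr_distr) (auto simp: comp_def intro!: distr_cong P1_D(2)[OF assms(1)])
  moreover have "distr ?\<gamma> \<eta>' snd = distr lam01 borel (quantile \<eta>')"
    by (subst distr_distr) (auto simp: comp_def intro!: distr_cong P1_D(2)[OF assms(2)])
  ultimately have "?\<gamma> \<in> couplings \<eta> \<eta>'"
    by (simp add: couplings_def distr_quantile assms)
  then have "W1 \<eta> \<eta>' \<le> (\<integral>\<^sup>+(y, y'). ennreal \<bar>y - y'\<bar> \<partial>?\<gamma>)"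
    unfolding W1_def by (rule INF_lower)
  also have "\<dots> = (\<integral>\<^sup>+u. ennreal \<bar>quantile \<eta> u - quantile \<eta>' u\<bar> \<partial>lam01)"
    by (subst nn_integral_distr) (auto simp: case_prod_beta')
  finally show ?thesis .
qed

text \<open>
  Between stochastically ordered measures the quantile coupling moves all mass in one direction, so
  its cost is the displacement of the mean, which is also a lower bound for the cost.
\<close>

lemma W1_eq_mean_diff:
  assumes "\<eta> \<in> P1" "\<eta>' \<in> P1" and "st_le \<eta> \<eta>' \<or> st_le \<eta>' \<eta>"
  shows "W1 \<eta> \<eta>' = ennreal \<bar>mean \<eta> - mean \<eta>'\<bar>"
proof (rule antisym)
  let ?d = "\<lambda>u. quantile \<eta> u - quantile \<eta>' u"
  have int: "integrable lam01 ?d" and mean: "(\<integral>u. ?d u \<partial>lam01) = mean \<eta> - mean \<eta>'"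
    using integrable_quantile[OF assms(1)] integrable_quantile[OF assms(2)]
      integral_quantile[OF assms(1)] integral_quantile[OF assms(2)] by auto
  have "(\<integral>u. \<bar>?d u\<bar> \<partial>lam01) = \<bar>\<integral>u. ?d u \<partial>lam01\<bar>"
    using assms(3)
  proof
    assume "st_le \<eta> \<eta>'"
    then have neg: "?d u \<le> 0" if "u \<in> space lam01" for u using that by (simp add: st_le_def)
    then have "(\<integral>u. \<bar>?d u\<bar> \<partial>lam01) = (\<integral>u. - ?d u \<partial>lam01)"
      by (intro Bochner_Integration.integral_cong) auto
    moreover have "(\<integral>u. - ?d u \<partial>lam01) \<ge> 0" using neg by (intro integral_nonneg_AE) auto
    moreover have "(\<integral>u. - ?d u \<partial>lam01) = - (\<integral>u. ?d u \<partial>lam01)" by (rule integral_minus)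
    ultimately show ?thesis by linarith
  next
    assume "st_le \<eta>' \<eta>"
    then have pos: "?d u \<ge> 0" if "u \<in> space lam01" for u using that by (simp add: st_le_def)
    then have "(\<integral>u. \<bar>?d u\<bar> \<partial>lam01) = (\<integral>u. ?d u \<partial>lam01)"
      by (intro Bochner_Integration.integral_cong) auto
    moreover have "(\<integral>u. ?d u \<partial>lam01) \<ge> 0" using pos by (intro integral_nonneg_AE) auto
    ultimately show ?thesis by simp
  qed
  then have "(\<integral>\<^sup>+u. ennreal \<bar>?d u\<bar> \<partial>lam01) = ennreal \<bar>mean \<eta> - mean \<eta>'\<bar>"
    using int by (subst nn_integral_eq_integral) (auto simp: mean)
  then show "W1 \<eta> \<eta>' \<le> ennreal \<bar>mean \<eta> - mean \<eta>'\<bar>"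
    using W1_le_quantile_cost[OF assms(1,2)] by simp
qed (rule W1_ge_mean_diff[OF assms(1,2)])

section \<open>Lifted couplings and their kernels\<close>

lemma kernel_D:
  assumes "p \<in> lam01 \<rightarrow>\<^sub>M prob_algebra borel" "u \<in> {0<..<1}"
  shows "prob_space (p u)" "sets (p u) = sets borel" "space (p u) = UNIV"
  using measurable_space[OF assms(1), of u] assms(2) sets_eq_imp_space_eq[of "p u" borel]
  by (auto simp: space_prob_algebra)

context
  fixes \<mu> :: "real measure" and p :: "real \<Rightarrow> real measure"
  assumes \<mu>: "\<mu> \<in> P1" and p [measurable]: "p \<in> lam01 \<rightarrow>\<^sub>M prob_algebra borel"
begin

lemma measurable_quantile_fixed [measurable]: "quantile \<mu> \<in> borel_measurable lam01"
  by (rule measurable_quantile[OF \<mu>])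

lemma measurable_lift_fibre:
  "(\<lambda>u. p u \<bind> (\<lambda>y. return (lam01 \<Otimes>\<^sub>M borel \<Otimes>\<^sub>M borel) (u, quantile \<mu> u, y)))
     \<in> lam01 \<rightarrow>\<^sub>M prob_algebra (lam01 \<Otimes>\<^sub>M borel \<Otimes>\<^sub>M borel)"
  by (intro measurable_bind_prob_space2[where N=borel] p) measurable

lemma lift_fibre_eq_distr:
  assumes "u \<in> {0<..<1}"
  shows "p u \<bind> (\<lambda>y. return (lam01 \<Otimes>\<^sub>M borel \<Otimes>\<^sub>M borel) (u, quantile \<mu> u, y))
    = distr (p u) (lam01 \<Otimes>\<^sub>M borel \<Otimes>\<^sub>M borel) (\<lambda>y. (u, quantile \<mu> u, y))"
  using kernel_D[OF p assms] assms
  by (intro bind_return_distr') (auto cong: measurable_cong_sets)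

lemma emeasure_lift_rectangle:
  assumes "U \<in> sets lam01" "B \<in> sets borel"
  shows "emeasure (lift \<mu> p) (U \<times> UNIV \<times> B) = (\<integral>\<^sup>+u. emeasure (p u) B * indicator U u \<partial>lam01)"
proof -
  have [measurable]: "U \<times> UNIV \<times> B \<in> sets (lam01 \<Otimes>\<^sub>M (borel :: real measure) \<Otimes>\<^sub>M borel)"
    using assms by (intro pair_measureI) auto
  have "emeasure (lift \<mu> p) (U \<times> UNIV \<times> B) = (\<integral>\<^sup>+u. emeasure (p u \<bind>
      (\<lambda>y. return (lam01 \<Otimes>\<^sub>M borel \<Otimes>\<^sub>M borel) (u, quantile \<mu> u, y))) (U \<times> UNIV \<times> B) \<partial>lam01)"
    unfolding lift_def
    by (intro emeasure_bind[OF _ measurable_prob_algebraD[OF measurable_lift_fibre]]) auto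
  also have "\<dots> = (\<integral>\<^sup>+u. emeasure (p u) B * indicator U u \<partial>lam01)"
  proof (intro nn_integral_cong)
    fix u assume "u \<in> space lam01"
    then have u: "u \<in> {0<..<1}" by simp
    have "emeasure (distr (p u) (lam01 \<Otimes>\<^sub>M borel \<Otimes>\<^sub>M borel) (\<lambda>y. (u, quantile \<mu> u, y))) (U \<times> UNIV \<times> B)
      = emeasure (p u) ((\<lambda>y. (u, quantile \<mu> u, y)) -` (U \<times> UNIV \<times> B) \<inter> space (p u))"
      using u kernel_D[OF p u] by (intro emeasure_distr) (auto cong: measurable_cong_sets)
    also have "(\<lambda>y. (u, quantile \<mu> u, y)) -` (U \<times> UNIV \<times> B) \<inter> space (p u) = (if u \<in> U then B else {})"
      using kernel_D[OF p u] by auto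
    finally show "emeasure (p u \<bind> (\<lambda>y. return (lam01 \<Otimes>\<^sub>M borel \<Otimes>\<^sub>M borel) (u, quantile \<mu> u, y)))
        (U \<times> UNIV \<times> B) = emeasure (p u) B * indicator U u"
      by (simp add: lift_fibre_eq_distr[OF u])
  qed
  finally show ?thesis .
qed

lemma sets_lift: "sets (lift \<mu> p) = sets (lam01 \<Otimes>\<^sub>M borel \<Otimes>\<^sub>M borel)"
  unfolding lift_def
  by (rule sets_bind_measurable[OF measurable_prob_algebraD[OF measurable_lift_fibre]]) auto

lemma third_marginal_lift: "distr (lift \<mu> p) borel (\<lambda>(u, x, y). y) = lam01 \<bind> p"
proof (rule measure_eqI)
  show "sets (distr (lift \<mu> p) borel (\<lambda>(u, x, y). y)) = sets (lam01 \<bind> p)"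
    using sets_bind_measurable[OF measurable_prob_algebraD[OF p]] by simp
next
  fix B assume "B \<in> sets (distr (lift \<mu> p) borel (\<lambda>(u, x, y). y))"
  then have B: "B \<in> sets borel" by simp
  have "emeasure (distr (lift \<mu> p) borel (\<lambda>(u, x, y). y)) B
      = emeasure (lift \<mu> p) ((\<lambda>(u, x, y). y) -` B \<inter> space (lift \<mu> p))"
    using B by (intro emeasure_distr) (auto simp: measurable_cong_sets[OF sets_lift refl])
  also have "(\<lambda>(u, x, y). y) -` B \<inter> space (lift \<mu> p) = space lam01 \<times> UNIV \<times> B"
    by (auto simp: sets_eq_imp_space_eq[OF sets_lift] space_pair_measure)
  also have "emeasure (lift \<mu> p) \<dots> = (\<integral>\<^sup>+u. emeasure (p u) B * indicator (space lam01) u \<partial>lam01)"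
    using B by (intro emeasure_lift_rectangle sets.top)
  also have "\<dots> = (\<integral>\<^sup>+u. emeasure (p u) B \<partial>lam01)"
    by (intro nn_integral_cong) auto
  also have "\<dots> = emeasure (lam01 \<bind> p) B"
    using B by (intro emeasure_bind[symmetric, OF _ measurable_prob_algebraD[OF p]]) auto
  finally show "emeasure (distr (lift \<mu> p) borel (\<lambda>(u, x, y). y)) B = emeasure (lam01 \<bind> p) B" .
qed

end

lemma real_distribution_eq_if_cdf_eq_on_Rats:
  assumes "real_distribution M" "real_distribution N"
    and eq: "\<And>q. q \<in> \<rat> \<Longrightarrow> cdf M q = cdf N q"
  shows "M = N"
proof (rule cdf_unique[OF assms(1,2)], rule ext)
  fix x
  interpret M: real_distribution M by fact
  interpret N: real_distribution N by fact
  have "\<exists>q\<in>\<rat>. x < q \<and> q < x + 1 / Suc n" for n by (rule Rats_dense_in_real) simp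
  then obtain q where q: "\<And>n. q n \<in> \<rat>" "\<And>n. x < q n" "\<And>n. q n < x + 1 / Suc n" by metis
  have "(\<lambda>n. x + 1 / Suc n) \<longlonglongrightarrow> x + 0"
    by (intro tendsto_add tendsto_const LIMSEQ_Suc[OF lim_1_over_n])
  then have "q \<longlonglongrightarrow> x"
    using q(2,3) by (intro tendsto_sandwich[of "\<lambda>_. x" q sequentially "\<lambda>n. x + 1 / Suc n"])
      (auto intro!: always_eventually less_imp_le)
  then have "filterlim q (at_right x) sequentially"
    using q(2) by (auto simp: filterlim_at less_imp_neq[symmetric])
  then have "(\<lambda>n. cdf M (q n)) \<longlonglongrightarrow> cdf M x" "(\<lambda>n. cdf N (q n)) \<longlonglongrightarrow> cdf N x"
    using M.cdf_is_right_cont[of x] N.cdf_is_right_cont[of x]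
    by (auto simp: continuous_within intro: filterlim_compose)
  then show "cdf M x = cdf N x"
    using LIMSEQ_unique by (simp add: eq q(1)) blast
qed

text \<open>
  The kernel of a lifted coupling is unique up to null sets: integrating over all \<open>U\<close> identifies
  \<open>u \<mapsto> p\<^sub>u(B)\<close> for each \<open>B\<close>, and the countably many half-lines with rational end point suffice.
\<close>

lemma lift_kernel_unique:
  assumes \<mu>: "\<mu> \<in> P1" and p: "p \<in> lam01 \<rightarrow>\<^sub>M prob_algebra borel"
    and p': "p' \<in> lam01 \<rightarrow>\<^sub>M prob_algebra borel" and eq: "lift \<mu> p = lift \<mu> p'"
  shows "AE u in lam01. p u = p' u"
proof -
  have "AE u in lam01. emeasure (p u) {..q} = emeasure (p' u) {..q}" for q :: real
  proof -
    have [measurable]: "(\<lambda>u. emeasure (p u) {..q}) \<in> borel_measurable lam01"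
      "(\<lambda>u. emeasure (p' u) {..q}) \<in> borel_measurable lam01"
      by (rule measurable_emeasure_kernel[OF measurable_prob_algebraD], fact, simp)+
    have "density lam01 (\<lambda>u. emeasure (p u) {..q}) = density lam01 (\<lambda>u. emeasure (p' u) {..q})"
    proof (rule measure_eqI)
      fix U assume "U \<in> sets (density lam01 (\<lambda>u. emeasure (p u) {..q}))"
      then have U: "U \<in> sets lam01" by simp
      show "emeasure (density lam01 (\<lambda>u. emeasure (p u) {..q})) U
          = emeasure (density lam01 (\<lambda>u. emeasure (p' u) {..q})) U"
        using emeasure_lift_rectangle[OF \<mu> p U, of "{..q}"] emeasure_lift_rectangle[OF \<mu> p' U, of "{..q}"]
        by (simp add: emeasure_density U eq)
    qed simp
    then show ?thesis
      by (subst (asm) lam01.density_unique_iff) auto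
  qed
  then have "AE u in lam01. \<forall>q\<in>\<rat>. emeasure (p u) {..q} = emeasure (p' u) {..q}"
    by (intro AE_ball_countable[THEN iffD2] ballI countable_rat) auto
  then show ?thesis
  proof (rule AE_mp, intro AE_I2 impI)
    fix u assume "u \<in> space lam01" and eq: "\<forall>q\<in>\<rat>. emeasure (p u) {..q} = emeasure (p' u) {..q}"
    then have u: "u \<in> {0<..<1}" by simp
    have "real_distribution (p u)" "real_distribution (p' u)"
      using kernel_D[OF p u] kernel_D[OF p' u]
      by (auto simp: real_distribution_def real_distribution_axioms_def)
    then show "p u = p' u"
      using eq by (intro real_distribution_eq_if_cdf_eq_on_Rats) (auto simp: cdf_def measure_def)
  qed
qed

lemma lifted_kernel_lift:
  assumes \<mu>: "\<mu> \<in> P1" and p: "p \<in> lam01 \<rightarrow>\<^sub>M prob_algebra borel"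
  shows "AE u in lam01. lifted_kernel \<mu> (lift \<mu> p) u = p u"
proof -
  let ?r = "lifted_kernel \<mu> (lift \<mu> p)"
  have "?r \<in> lam01 \<rightarrow>\<^sub>M prob_algebra borel \<and> lift \<mu> p = lift \<mu> ?r"
    unfolding lifted_kernel_def by (rule someI[of _ p]) (simp add: p)
  then show ?thesis
    using lift_kernel_unique[OF \<mu> _ p, of ?r] by simp
qed

section \<open>Bounds for the lifted adapted distance\<close>

lemma couplings_AE:
  assumes "\<theta> \<in> couplings M N"
  shows "AE u in M. P u \<Longrightarrow> AE z in \<theta>. P (fst z)" "AE v in N. Q v \<Longrightarrow> AE z in \<theta>. Q (snd z)"
  using AE_distrD[OF couplings_D(1)[OF assms], of P] AE_distrD[OF couplings_D(2)[OF assms], of Q]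
  unfolding couplings_D(3,4)[OF assms] by simp_all

text \<open>
  Pointwise, \<open>\<bar>Q(u) - Q(u')\<bar> + \<bar>G(u) - Q(u')\<bar> \<ge> \<bar>G(u) - Q(u)\<bar>\<close>, where \<open>Q(u')\<close> is the mean of the
  second kernel at \<open>u'\<close>. The right-hand side depends on \<open>u\<close> only, so its integral is the same for
  every coupling of the parameters.
\<close>

lemma AW1_ge_barycentre_defect:
  assumes \<mu>: "\<mu> \<in> P1" and p: "p \<in> lam01 \<rightarrow>\<^sub>M prob_algebra borel"
    and p': "p' \<in> lam01 \<rightarrow>\<^sub>M prob_algebra borel"
    and int: "\<And>u. u \<in> {0<..<1} \<Longrightarrow> p u \<in> P1"
    and mart: "AE u in lam01. integrable (p' u) (\<lambda>y. y) \<and> mean (p' u) = quantile \<mu> u"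
  shows "(\<integral>\<^sup>+u. ennreal \<bar>mean (p u) - quantile \<mu> u\<bar> \<partial>lam01) \<le> AW1 \<mu> \<mu> (lift \<mu> p) (lift \<mu> p')"
  unfolding AW1_def
proof (rule INF_greatest)
  fix \<theta> assume \<theta>: "\<theta> \<in> couplings lam01 lam01"
  have [measurable]: "quantile \<mu> \<in> borel_measurable lam01" by (rule measurable_quantile[OF \<mu>])
  have "(\<lambda>u. \<integral>y. y \<partial>p u) \<in> borel_measurable lam01"
    by (rule measurable_compose[OF measurable_prob_algebraD[OF p]
        integral_measurable_subprob_algebra]) simp
  then have [measurable]: "(\<lambda>u. mean (p u)) \<in> borel_measurable lam01"
    by (simp add: mean_def)
  have "AE u in lam01. lifted_kernel \<mu> (lift \<mu> p) u \<in> P1 \<and>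
      mean (lifted_kernel \<mu> (lift \<mu> p) u) = mean (p u)"
    using lifted_kernel_lift[OF \<mu> p] by (rule AE_mp) (auto intro!: AE_I2 int)
  note A = couplings_AE(1)[OF \<theta> this]
  have "AE u in lam01. lifted_kernel \<mu> (lift \<mu> p') u \<in> P1 \<and>
      mean (lifted_kernel \<mu> (lift \<mu> p') u) = quantile \<mu> u"
    using lifted_kernel_lift[OF \<mu> p'] mart AE_space
  proof eventually_elim
    case (elim u)
    then show ?case using kernel_D[OF p', of u] by (auto simp: P1_def)
  qed
  note B = couplings_AE(2)[OF \<theta> this]
  have "(\<integral>\<^sup>+u. ennreal \<bar>mean (p u) - quantile \<mu> u\<bar> \<partial>lam01)
      = (\<integral>\<^sup>+u. ennreal \<bar>mean (p u) - quantile \<mu> u\<bar> \<partial>distr \<theta> lam01 fst)"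
    by (simp add: couplings_D(3)[OF \<theta>])
  also have "\<dots> = (\<integral>\<^sup>+z. ennreal \<bar>mean (p (fst z)) - quantile \<mu> (fst z)\<bar> \<partial>\<theta>)"
    using couplings_D(1)[OF \<theta>] by (subst nn_integral_distr) auto
  also have "\<dots> \<le> (\<integral>\<^sup>+(u, u'). ennreal \<bar>u - u'\<bar> + ennreal \<bar>quantile \<mu> u - quantile \<mu> u'\<bar>
      + W1 (lifted_kernel \<mu> (lift \<mu> p) u) (lifted_kernel \<mu> (lift \<mu> p') u') \<partial>\<theta>)"
  proof (rule nn_integral_mono_AE)
    show "AE z in \<theta>. ennreal \<bar>mean (p (fst z)) - quantile \<mu> (fst z)\<bar> \<le>
      (case z of (u, u') \<Rightarrow> ennreal \<bar>u - u'\<bar> + ennreal \<bar>quantile \<mu> u - quantile \<mu> u'\<bar>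
      + W1 (lifted_kernel \<mu> (lift \<mu> p) u) (lifted_kernel \<mu> (lift \<mu> p') u'))"
      using A B
    proof eventually_elim
      case (elim z)
      obtain u u' where z: "z = (u, u')" by (cases z)
      have "ennreal \<bar>mean (p u) - quantile \<mu> u\<bar>
          \<le> ennreal (\<bar>u - u'\<bar> + \<bar>quantile \<mu> u - quantile \<mu> u'\<bar> + \<bar>mean (p u) - quantile \<mu> u'\<bar>)"
        by (intro ennreal_leI) linarith
      also have "\<dots> = ennreal \<bar>u - u'\<bar> + ennreal \<bar>quantile \<mu> u - quantile \<mu> u'\<bar>
          + ennreal \<bar>mean (p u) - quantile \<mu> u'\<bar>"
        by (simp add: ennreal_plus)
      also have "ennreal \<bar>mean (p u) - quantile \<mu> u'\<bar>
          \<le> W1 (lifted_kernel \<mu> (lift \<mu> p) u) (lifted_kernel \<mu> (lift \<mu> p') u')"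
        using W1_ge_mean_diff[of "lifted_kernel \<mu> (lift \<mu> p) u" "lifted_kernel \<mu> (lift \<mu> p') u'"] elim
        by (simp add: z)
      finally show ?case by (simp add: z add_left_mono)
    qed
  qed
  finally show "(\<integral>\<^sup>+u. ennreal \<bar>mean (p u) - quantile \<mu> u\<bar> \<partial>lam01) \<le>
      (\<integral>\<^sup>+(u, u'). ennreal \<bar>u - u'\<bar> + ennreal \<bar>quantile \<mu> u - quantile \<mu> u'\<bar>
      + W1 (lifted_kernel \<mu> (lift \<mu> p) u) (lifted_kernel \<mu> (lift \<mu> p') u') \<partial>\<theta>)" .
qed

text \<open>
  A simple function below \<open>f\<close> pulls back along \<open>T\<close> to a simple function below \<open>f \<circ> T\<close>. The inequality
  thus covers the cost \<^const>\<open>W1\<close> between two kernels, regarded as an arbitrary function.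
\<close>

lemma nn_integral_distr_le:
  assumes T: "T \<in> M \<rightarrow>\<^sub>M N"
  shows "(\<integral>\<^sup>+y. f y \<partial>distr M N T) \<le> (\<integral>\<^sup>+x. f (T x) \<partial>M)"
  unfolding nn_integral_def[of "distr M N T"]
proof (rule SUP_least)
  fix s assume "s \<in> {g. simple_function (distr M N T) g \<and> g \<le> f}"
  then have s: "simple_function (distr M N T) s" "simple_function N s" "s \<le> f"
    by (auto simp: simple_function_def)
  have "integral\<^sup>S (distr M N T) s = integral\<^sup>N (distr M N T) s"
    using s(1) by (rule nn_integral_eq_simple_integral[symmetric])
  also have "\<dots> = (\<integral>\<^sup>+x. s (T x) \<partial>M)"
    using s(2) by (intro nn_integral_distr T) (auto intro: borel_measurable_simple_function)
  also have "\<dots> \<le> (\<integral>\<^sup>+x. f (T x) \<partial>M)"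
    using s(3) by (intro nn_integral_mono) (auto simp: le_fun_def)
  finally show "integral\<^sup>S (distr M N T) s \<le> (\<integral>\<^sup>+x. f (T x) \<partial>M)" .
qed

lemma AW1_le_diagonal:
  assumes \<mu>: "\<mu> \<in> P1" and p: "p \<in> lam01 \<rightarrow>\<^sub>M prob_algebra borel"
    and p': "p' \<in> lam01 \<rightarrow>\<^sub>M prob_algebra borel"
  shows "AW1 \<mu> \<mu> (lift \<mu> p) (lift \<mu> p') \<le> (\<integral>\<^sup>+u. W1 (p u) (p' u) \<partial>lam01)"
proof -
  let ?\<theta> = "distr lam01 (lam01 \<Otimes>\<^sub>M lam01) (\<lambda>u. (u, u))"
  let ?c = "\<lambda>(u, u'). ennreal \<bar>u - u'\<bar> + ennreal \<bar>quantile \<mu> u - quantile \<mu> u'\<bar>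
      + W1 (lifted_kernel \<mu> (lift \<mu> p) u) (lifted_kernel \<mu> (lift \<mu> p') u')"
  have "?\<theta> \<in> couplings lam01 lam01"
    by (simp add: couplings_def distr_distr comp_def)
  then have "AW1 \<mu> \<mu> (lift \<mu> p) (lift \<mu> p') \<le> (\<integral>\<^sup>+z. ?c z \<partial>?\<theta>)"
    unfolding AW1_def by (rule INF_lower)
  also have "\<dots> \<le> (\<integral>\<^sup>+u. ?c (u, u) \<partial>lam01)"
    by (intro nn_integral_distr_le) auto
  also have "\<dots> = (\<integral>\<^sup>+u. W1 (p u) (p' u) \<partial>lam01)"
  proof (rule nn_integral_cong_AE)
    show "AE u in lam01. ?c (u, u) = W1 (p u) (p' u)"
      using lifted_kernel_lift[OF \<mu> p] lifted_kernel_lift[OF \<mu> p'] by eventually_elim auto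
  qed
  finally show ?thesis .
qed

section \<open>The weak Borel algebra and the Giry algebra on \<open>P1\<close>\<close>

lemma topspace_P1_weak_topology: "topspace P1_weak_topology = P1"
proof
  have "P1 = {\<eta>\<in>P1. (\<integral>y. (\<lambda>_. 0 :: real) y \<partial>\<eta>) \<in> UNIV}" by simp
  then show "P1 \<subseteq> topspace P1_weak_topology"
    unfolding P1_weak_topology_def topology_generated_by_topspace
    by (intro Union_upper CollectI exI[of _ "\<lambda>_. 0"] exI[of _ UNIV]) simp
qed (auto simp: P1_weak_topology_def topology_generated_by_topspace)

lemma weakly_open_subset_P1: "{V. openin P1_weak_topology V} \<subseteq> Pow P1"
  using openin_subset[of P1_weak_topology] by (auto simp: topspace_P1_weak_topology)

lemma space_P1_borel: "space P1_borel = P1"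
  unfolding P1_borel_def by (rule space_measure_of[OF weakly_open_subset_P1])

lemma sets_P1_borel: "sets P1_borel = sigma_sets P1 {V. openin P1_weak_topology V}"
  unfolding P1_borel_def by (rule sets_measure_of[OF weakly_open_subset_P1])

lemma measurable_integral_P1_borel:
  fixes f :: "real \<Rightarrow> real"
  assumes "continuous_on UNIV f" "bounded (range f)"
  shows "(\<lambda>\<eta>. \<integral>y. f y \<partial>\<eta>) \<in> borel_measurable P1_borel"
proof (rule borel_measurableI)
  fix V :: "real set" assume V: "open V"
  have "openin P1_weak_topology {\<eta>\<in>P1. (\<integral>y. f y \<partial>\<eta>) \<in> V}"
    unfolding P1_weak_topology_def using assms V by (intro topology_generated_by_Basis) auto
  then show "(\<lambda>\<eta>. \<integral>y. f y \<partial>\<eta>) -` V \<inter> space P1_borel \<in> sets P1_borel"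
    by (auto simp: space_P1_borel sets_P1_borel vimage_def Int_def conj_commute intro!: sigma_sets.Basic)
qed

lemma cts_step_abs_le_1: "a < b \<Longrightarrow> \<bar>cts_step a b x\<bar> \<le> 1"
  by (auto simp: cts_step_def divide_le_eq)

text \<open>
  A half-line indicator is the pointwise limit of bounded continuous functions, so evaluations at
  half-lines, which generate the Giry algebra, are measurable for the weak Borel algebra.
\<close>

lemma measurable_P1_borel_imp_prob_algebra:
  assumes "f \<in> M \<rightarrow>\<^sub>M P1_borel"
  shows "f \<in> M \<rightarrow>\<^sub>M prob_algebra borel"
proof -
  have "(\<lambda>\<eta>. \<eta>) \<in> P1_borel \<rightarrow>\<^sub>M prob_algebra borel"
  proof (rule measurable_prob_algebra_generated[where \<Omega>=UNIV and G="range atMost"])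
    show "sets borel = sigma_sets UNIV (range (atMost :: real \<Rightarrow> _))"
      by (subst borel_eq_atMost) (auto simp: image_def)
    show "Int_stable (range (atMost :: real \<Rightarrow> _))"
    proof (rule Int_stableI, clarify)
      fix a b :: real
      have "{..a} \<inter> {..b} = {..min a b}" by auto
      then show "{..a} \<inter> {..b} \<in> range atMost" by simp
    qed
    fix A :: "real set" assume "A \<in> range atMost"
    then obtain a where A: "A = {..a}" by auto
    let ?h = "\<lambda>n. cts_step a (a + 1 / Suc n)"
    have meas: "(\<lambda>\<eta>. \<integral>y. ?h n y \<partial>\<eta>) \<in> borel_measurable P1_borel" for n
    proof (rule measurable_integral_P1_borel)
      show "continuous_on UNIV (?h n)"
        by (intro uniformly_continuous_imp_continuous cts_step_uniformly_continuous) auto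
      show "bounded (range (?h n))"
        by (intro boundedI[of _ 1]) (auto intro!: cts_step_abs_le_1)
    qed
    have lim: "(\<lambda>n. \<integral>y. ?h n y \<partial>\<eta>) \<longlonglongrightarrow> measure \<eta> {..a}" if \<eta>: "\<eta> \<in> P1" for \<eta>
    proof -
      interpret real_distribution \<eta>
        using cdf_distribution_P1[OF \<eta>] by (simp add: cdf_distribution_def)
      have "(\<lambda>n. \<integral>y. ?h n y \<partial>\<eta>) \<longlonglongrightarrow> (\<integral>y. indicat_real {..a} y \<partial>\<eta>)"
      proof (rule integral_dominated_convergence[where w="\<lambda>_. 1"])
        show "AE y in \<eta>. (\<lambda>n. ?h n y) \<longlonglongrightarrow> indicat_real {..a} y"
        proof (rule AE_I2)
          fix y
          show "(\<lambda>n. ?h n y) \<longlonglongrightarrow> indicat_real {..a} y"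
          proof (cases "y \<le> a")
            case False
            have "(\<lambda>n. a + 1 / Suc n) \<longlonglongrightarrow> a + 0"
              by (intro tendsto_add tendsto_const LIMSEQ_Suc[OF lim_1_over_n])
            then have "eventually (\<lambda>n. a + 1 / Suc n < y) sequentially"
              using False by (intro order_tendstoD) auto
            then have "eventually (\<lambda>n. ?h n y = 0) sequentially"
              by (rule eventually_mono) (use False in \<open>auto simp: cts_step_def\<close>)
            then show ?thesis using False by (simp add: tendsto_eventually)
          qed (simp add: cts_step_def)
        qed
        show "?h n \<in> borel_measurable \<eta>" for n
        proof -
          have "?h n \<in> borel_measurable borel"
            by (intro borel_measurable_continuous_onI uniformly_continuous_imp_continuous
                cts_step_uniformly_continuous) auto
          then show ?thesis by simp
        qed
        show "AE y in \<eta>. norm (?h n y) \<le> 1" for n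
          by (auto intro!: AE_I2 cts_step_abs_le_1)
      qed auto
      then show ?thesis by simp
    qed
    have "(\<lambda>\<eta>. measure \<eta> {..a}) \<in> borel_measurable P1_borel"
      by (rule borel_measurable_LIMSEQ_real[OF _ meas]) (use lim in \<open>auto simp: space_P1_borel\<close>)
    then have "(\<lambda>\<eta>. ennreal (measure \<eta> {..a})) \<in> borel_measurable P1_borel"
      by (rule measurable_compose[OF _ measurable_ennreal])
    moreover have eq: "ennreal (measure \<eta> {..a}) = emeasure \<eta> {..a}" if "\<eta> \<in> space P1_borel" for \<eta>
    proof -
      interpret prob_space \<eta> using that P1_D(1) by (simp add: space_P1_borel)
      show ?thesis by (rule emeasure_eq_measure[symmetric])
    qed
    ultimately show "(\<lambda>\<eta>. emeasure \<eta> A) \<in> borel_measurable P1_borel"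
      unfolding A 
      using measurable_cong[of P1_borel "\<lambda>\<eta>. ennreal (measure \<eta> {..a})" "\<lambda>\<eta>. emeasure \<eta> {..a}" borel, OF eq]
      by blast
  qed (auto simp: space_P1_borel P1_D)
  then show ?thesis by (rule measurable_compose[OF assms])
qed

text \<open>
  Conversely, every weakly open set is a countable union of finite intersections of cylinders. A
  cylinder requires that the integral of a rational step function lies in a rational interval and
  that little mass sits outside a bounded interval. By tightness and uniform continuity, the two
  conditions control the integral of any given bounded continuous function. The step function lives
  on \<open>{-N..<N}\<close> and has grid width \<open>1/n\<close>.
\<close>

definition grid_step :: "nat \<Rightarrow> nat \<Rightarrow> rat list \<Rightarrow> real \<Rightarrow> real" where
  "grid_step n N vs x =
     (let k = nat \<lfloor>real n * (x + real N)\<rfloor>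
      in if - real N \<le> x \<and> k < length vs then of_rat (vs ! k) else 0)"

definition weak_cylinder :: "nat \<times> nat \<times> rat list \<times> rat \<times> rat \<times> rat \<Rightarrow> real measure set" where
  "weak_cylinder = (\<lambda>(n, N, vs, p, q, r). {\<eta>\<in>P1.
     of_rat p < (\<integral>y. grid_step n N vs y \<partial>\<eta>) \<and> (\<integral>y. grid_step n N vs y \<partial>\<eta>) < of_rat q \<and>
     of_rat r < measure \<eta> {- real N..<real N}})"

lemma measurable_grid_step [measurable]: "grid_step n N vs \<in> borel_measurable borel"
  unfolding grid_step_def Let_def by measurable

lemma grid_step_bounded: "\<exists>C. \<forall>x. \<bar>grid_step n N vs x\<bar> \<le> C"
proof (intro exI allI)
  fix x
  show "\<bar>grid_step n N vs x\<bar> \<le> (\<Sum>v\<leftarrow>vs. \<bar>of_rat v\<bar>)"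
  proof -
    have "\<bar>of_rat (vs ! k)\<bar> \<le> (\<Sum>v\<leftarrow>vs. \<bar>of_rat v :: real\<bar>)" if "k < length vs" for k
      using that by (intro member_le_sum_list) auto
    moreover have "0 \<le> (\<Sum>v\<leftarrow>vs. \<bar>of_rat v :: real\<bar>)" by (intro sum_list_nonneg) auto
    ultimately show ?thesis by (auto simp: grid_step_def Let_def)
  qed
qed

lemma grid_step_approximation:
  fixes f :: "real \<Rightarrow> real"
  assumes f: "continuous_on UNIV f" and "\<delta> > 0"
  obtains n vs where "\<And>x. - real N \<le> x \<Longrightarrow> x < real N \<Longrightarrow> \<bar>f x - grid_step n N vs x\<bar> \<le> \<delta>"
    and "\<And>x. \<not> (- real N \<le> x \<and> x < real N) \<Longrightarrow> grid_step n N vs x = 0"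
proof -
  have "uniformly_continuous_on {- real N..real N} f"
    using f by (intro compact_uniformly_continuous continuous_on_subset[OF f]) auto
  then obtain d where d: "d > 0" "\<And>x y. x \<in> {- real N..real N} \<Longrightarrow> y \<in> {- real N..real N} \<Longrightarrow>
      dist y x < d \<Longrightarrow> dist (f y) (f x) < \<delta> / 2"
    using \<open>\<delta> > 0\<close> unfolding uniformly_continuous_on_def by (metis half_gt_zero)
  obtain n where n: "n > 0" "1 / real n < d"
    using d(1) by (metis inverse_eq_divide reals_Archimedean neq0_conv of_nat_0_less_iff real_arch_inverse)
  have "\<exists>q. \<bar>f y - of_rat q\<bar> < \<delta> / 2" for y
  proof -
    obtain q where "f y - \<delta> / 2 < of_rat q" "of_rat q < f y + \<delta> / 2"
      using of_rat_dense[of "f y - \<delta> / 2" "f y + \<delta> / 2"] \<open>\<delta> > 0\<close> by auto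
    then show ?thesis by (intro exI[of _ q]) linarith
  qed
  then obtain v where v: "\<And>y. \<bar>f y - of_rat (v y)\<bar> < \<delta> / 2" by metis
  define vs where "vs = map (\<lambda>k. v (- real N + real k / real n)) [0..<2 * N * n]"
  show ?thesis
  proof (rule that[of n vs])
    fix x assume x: "- real N \<le> x" "x < real N"
    define k where "k = nat \<lfloor>real n * (x + real N)\<rfloor>"
    define y where "y = - real N + real k / real n"
    have "0 \<le> real n * (x + real N)" using x by simp
    then have k: "real k \<le> real n * (x + real N)" "real n * (x + real N) < real k + 1"
      by (auto simp: k_def)
    have "real n * (x + real N) < real n * (2 * real N)" using x n by simp
    then have "real k < real (2 * N * n)" using k(1) by (simp add: mult_ac)
    then have kl: "k < 2 * N * n" by (simp only: of_nat_less_iff)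
    have "y \<le> x" "x < y + 1 / real n"
      using k n by (auto simp: y_def field_simps)
    then have "dist y x < d" "y \<in> {- real N..real N}" "x \<in> {- real N..real N}"
      using n x by (auto simp: dist_real_def y_def)
    then have "\<bar>f y - f x\<bar> < \<delta> / 2" using d(2)[of x y] by (simp add: dist_real_def)
    moreover have "grid_step n N vs x = of_rat (v y)"
      using kl x by (simp add: grid_step_def Let_def vs_def y_def flip: k_def)
    ultimately show "\<bar>f x - grid_step n N vs x\<bar> \<le> \<delta>"
      using v[of y] by linarith
  next
    fix x assume x: "\<not> (- real N \<le> x \<and> x < real N)"
    have "2 * N * n \<le> nat \<lfloor>real n * (x + real N)\<rfloor>" if "real N \<le> x"
    proof -
      have "real (2 * N * n) \<le> real n * (x + real N)"
        using that mult_left_mono[of "2 * real N" "x + real N" "real n"] by (simp add: mult_ac)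
      then show ?thesis by (simp add: le_nat_floor)
    qed
    then show "grid_step n N vs x = 0" using x by (auto simp: grid_step_def Let_def vs_def)
  qed
qed

lemma weak_cylinder_within_subbasic_set:
  fixes f :: "real \<Rightarrow> real"
  assumes f: "continuous_on UNIV f" "bounded (range f)" and V: "open V"
    and \<eta>: "\<eta> \<in> P1" "(\<integral>y. f y \<partial>\<eta>) \<in> V"
  shows "\<exists>c. \<eta> \<in> weak_cylinder c \<and> weak_cylinder c \<subseteq> {\<eta>\<in>P1. (\<integral>y. f y \<partial>\<eta>) \<in> V}"
proof -
  obtain e where e: "e > 0" "\<And>x. \<bar>x - (\<integral>y. f y \<partial>\<eta>)\<bar> < e \<Longrightarrow> x \<in> V"
    using V \<eta>(2) by (metis open_dist dist_real_def)
  obtain B where B: "B > 0" "\<And>x. \<bar>f x\<bar> \<le> B"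
    using f(2) by (auto simp: bounded_pos)
  have f_meas [measurable]: "f \<in> borel_measurable borel"
    using f(1) by (rule borel_measurable_continuous_onI)
  \<comment> \<open>Two approximation errors of \<open>2 \<delta>\<close> each and the width \<open>2 \<delta>\<close> of the window \<open>(p, q)\<close> add up to
    less than \<open>e\<close>. The bound \<open>r0\<close> on the mass makes the part of the error outside \<open>{-N..<N}\<close>
    at most \<open>B * (\<delta> / B)\<close>.\<close>
  define \<delta> where "\<delta> = e / 8"
  have \<delta>: "\<delta> > 0" using e by (simp add: \<delta>_def)
  define r0 where "r0 = 1 - \<delta> / B"
  have r0: "r0 < 1" using \<delta> B by (simp add: r0_def)
  interpret \<eta>: real_distribution \<eta>
    using cdf_distribution_P1[OF \<eta>(1)] by (simp add: cdf_distribution_def)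
  have "(\<lambda>N. measure \<eta> {- real N..<real N}) \<longlonglongrightarrow> measure \<eta> (\<Union>N. {- real N..<real N})"
    by (intro \<eta>.finite_Lim_measure_incseq) (auto simp: incseq_def)
  moreover have "(\<Union>N. {- real N..<real N}) = UNIV"
  proof (intro equalityI subsetI UNIV_I)
    fix x :: real
    obtain N where "\<bar>x\<bar> < real N" using reals_Archimedean2 by blast
    then show "x \<in> (\<Union>N. {- real N..<real N})" by (intro UN_I[of N]) auto
  qed
  ultimately have "(\<lambda>N. measure \<eta> {- real N..<real N}) \<longlonglongrightarrow> 1"
    using \<eta>.prob_space by simp
  then have "eventually (\<lambda>N. r0 < measure \<eta> {- real N..<real N}) sequentially"
    using r0 by (rule order_tendstoD)
  then obtain N where N: "r0 < measure \<eta> {- real N..<real N}"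
    using eventually_happens by fastforce
  obtain r where r: "r0 < of_rat r" "of_rat r < measure \<eta> {- real N..<real N}"
    using of_rat_dense[OF N] by auto
  obtain n vs where g: "\<And>x. - real N \<le> x \<Longrightarrow> x < real N \<Longrightarrow> \<bar>f x - grid_step n N vs x\<bar> \<le> \<delta>"
    "\<And>x. \<not> (- real N \<le> x \<and> x < real N) \<Longrightarrow> grid_step n N vs x = 0"
    using grid_step_approximation[OF f(1) \<delta>] by blast
  let ?g = "grid_step n N vs"
  obtain C where C: "\<And>x. \<bar>?g x\<bar> \<le> C" using grid_step_bounded by blast
  have close: "\<bar>(\<integral>y. f y \<partial>\<eta>') - (\<integral>y. ?g y \<partial>\<eta>')\<bar> \<le> 2 * \<delta>"
    if \<eta>': "\<eta>' \<in> P1" "r0 < measure \<eta>' {- real N..<real N}" for \<eta>'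
  proof -
    interpret \<eta>': real_distribution \<eta>'
      using cdf_distribution_P1[OF \<eta>'(1)] by (simp add: cdf_distribution_def)
    let ?I = "{- real N..<real N}"
    have ind: "integrable \<eta>' (\<lambda>y. B * indicator (- ?I) y)"
      by (intro integrable_mult_right integrable_real_indicator) (auto simp: less_top[symmetric])
    have [simp]: "integrable \<eta>' f" "integrable \<eta>' ?g"
      using \<eta>'.integrable_const_bound[of f B] \<eta>'.integrable_const_bound[of ?g C] B C by auto
    have "\<bar>(\<integral>y. f y \<partial>\<eta>') - (\<integral>y. ?g y \<partial>\<eta>')\<bar> = \<bar>\<integral>y. f y - ?g y \<partial>\<eta>'\<bar>" by simp
    also have "\<dots> \<le> (\<integral>y. \<bar>f y - ?g y\<bar> \<partial>\<eta>')" by (rule integral_abs_bound)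
    also have "\<dots> \<le> (\<integral>y. \<delta> + B * indicator (- ?I) y \<partial>\<eta>')"
    proof (rule integral_mono)
      show "\<bar>f y - ?g y\<bar> \<le> \<delta> + B * indicator (- ?I) y" for y
        using g[of y] B(2)[of y] \<delta> by (auto split: split_indicator)
      show "integrable \<eta>' (\<lambda>y. \<delta> + B * indicator (- ?I) y)"
        using ind by simp
    qed simp
    also have "\<dots> = \<delta> + B * (1 - measure \<eta>' ?I)"
      using \<eta>'.prob_compl[of ?I] \<eta>'.prob_space ind
      by (subst Bochner_Integration.integral_add) (auto simp: Compl_eq_Diff_UNIV)
    also have "B * (1 - measure \<eta>' ?I) \<le> B * (\<delta> / B)"
      using B \<eta>'(2) by (intro mult_left_mono) (auto simp: r0_def)
    finally show ?thesis using B by simp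
  qed
  obtain p where p: "(\<integral>y. ?g y \<partial>\<eta>) - \<delta> < of_rat p" "of_rat p < (\<integral>y. ?g y \<partial>\<eta>)"
    using of_rat_dense[of "(\<integral>y. ?g y \<partial>\<eta>) - \<delta>" "\<integral>y. ?g y \<partial>\<eta>"] \<delta> by auto
  obtain q where q: "(\<integral>y. ?g y \<partial>\<eta>) < of_rat q" "of_rat q < (\<integral>y. ?g y \<partial>\<eta>) + \<delta>"
    using of_rat_dense[of "\<integral>y. ?g y \<partial>\<eta>" "(\<integral>y. ?g y \<partial>\<eta>) + \<delta>"] \<delta> by auto
  show ?thesis
  proof (intro exI[of _ "(n, N, vs, p, q, r)"] conjI subsetI)
    show "\<eta> \<in> weak_cylinder (n, N, vs, p, q, r)"
      using \<eta> p q r by (simp add: weak_cylinder_def)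
    fix \<eta>' assume "\<eta>' \<in> weak_cylinder (n, N, vs, p, q, r)"
    then have \<eta>': "\<eta>' \<in> P1" "of_rat p < (\<integral>y. ?g y \<partial>\<eta>')" "(\<integral>y. ?g y \<partial>\<eta>') < of_rat q"
      "of_rat r < measure \<eta>' {- real N..<real N}" by (auto simp: weak_cylinder_def)
    have "\<bar>(\<integral>y. f y \<partial>\<eta>') - (\<integral>y. f y \<partial>\<eta>)\<bar> < e"
      using close[OF \<eta>'(1)] close[OF \<eta>(1) N] \<eta>' p q r \<delta>
      unfolding \<delta>_def abs_le_iff abs_less_iff by simp
    then show "\<eta>' \<in> {\<eta>\<in>P1. (\<integral>y. f y \<partial>\<eta>) \<in> V}" using e \<eta>' by auto
  qed
qed

lemma weak_cylinders_refine_open_set: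
  assumes "openin P1_weak_topology U" "\<eta> \<in> U"
  shows "\<exists>F. finite F \<and> \<eta> \<in> P1 \<inter> \<Inter>(weak_cylinder ` F) \<and> P1 \<inter> \<Inter>(weak_cylinder ` F) \<subseteq> U"
proof -
  have "generate_topology_on {{\<eta>\<in>P1. (\<integral>y. f y \<partial>\<eta>) \<in> V} | (f :: real \<Rightarrow> real) V.
        continuous_on UNIV f \<and> bounded (range f) \<and> open V} U"
    using assms(1) unfolding P1_weak_topology_def by (simp add: openin_topology_generated_by_iff)
  then show ?thesis using assms(2)
  proof (induction arbitrary: \<eta>)
    case (Int U V)
    from Int.IH(1)[of \<eta>] Int.IH(2)[of \<eta>] Int.prems obtain F G where
      "finite F" "\<eta> \<in> P1 \<inter> \<Inter>(weak_cylinder ` F)" "P1 \<inter> \<Inter>(weak_cylinder ` F) \<subseteq> U"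
      "finite G" "\<eta> \<in> P1 \<inter> \<Inter>(weak_cylinder ` G)" "P1 \<inter> \<Inter>(weak_cylinder ` G) \<subseteq> V"
      by auto
    then show ?case by (intro exI[of _ "F \<union> G"]) auto
  next
    case (UN K)
    then obtain k where "k \<in> K" "\<eta> \<in> k" by auto
    with UN.IH[of k \<eta>] show ?case by (meson Union_upper order_trans)
  next
    case (Basis s)
    from Basis(1) obtain f :: "real \<Rightarrow> real" and V where s: "continuous_on UNIV f" "bounded (range f)" "open V"
      "s = {\<eta>\<in>P1. (\<integral>y. f y \<partial>\<eta>) \<in> V}" by blast
    then obtain c where "\<eta> \<in> weak_cylinder c" "weak_cylinder c \<subseteq> s"
      using weak_cylinder_within_subbasic_set[OF s(1,2,3), of \<eta>] Basis(2) by auto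
    then show ?case using Basis(2) s(4) by (intro exI[of _ "{c}"]) auto
  qed auto
qed

lemma measurable_prob_algebra_imp_P1_borel:
  assumes f: "f \<in> M \<rightarrow>\<^sub>M prob_algebra borel" and P1: "\<And>x. x \<in> space M \<Longrightarrow> f x \<in> P1"
  shows "f \<in> M \<rightarrow>\<^sub>M P1_borel"
  unfolding P1_borel_def
proof (rule measurable_measure_of[OF weakly_open_subset_P1])
  show "f \<in> space M \<rightarrow> P1" using P1 by auto
  fix U assume "U \<in> {V. openin P1_weak_topology V}"
  then have U: "openin P1_weak_topology U" by simp
  note f' [measurable] = measurable_prob_algebraD[OF f]
  have cyl: "f -` weak_cylinder c \<inter> space M \<in> sets M" for c
  proof -
    obtain n N vs p q r where c: "c = (n, N, vs, p, q, r)" by (cases c)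
    have [measurable]: "(\<lambda>x. \<integral>y. grid_step n N vs y \<partial>f x) \<in> borel_measurable M"
      by (rule measurable_compose[OF f' integral_measurable_subprob_algebra]) simp
    have [measurable]: "(\<lambda>x. measure (f x) {- real N..<real N}) \<in> borel_measurable M"
      by (rule measurable_compose[OF f' measurable_measure_subprob_algebra]) simp
    have "f -` weak_cylinder c \<inter> space M = {x\<in>space M. of_rat p < (\<integral>y. grid_step n N vs y \<partial>f x) \<and>
        (\<integral>y. grid_step n N vs y \<partial>f x) < of_rat q \<and> of_rat r < measure (f x) {- real N..<real N}}"
      using P1 by (auto simp: c weak_cylinder_def)
    also have "\<dots> \<in> sets M" by measurable
    finally show ?thesis .
  qed
  define \<F> where "\<F> = {F. finite F \<and> P1 \<inter> \<Inter>(weak_cylinder ` F) \<subseteq> U}"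
  have "countable \<F>"
    by (rule countable_subset[OF _ countable_Collect_finite]) (auto simp: \<F>_def)
  moreover have "f -` (P1 \<inter> \<Inter>(weak_cylinder ` F)) \<inter> space M \<in> sets M" if "F \<in> \<F>" for F
  proof (cases "F = {}")
    case True
    then have "f -` (P1 \<inter> \<Inter>(weak_cylinder ` F)) \<inter> space M = space M" using P1 by auto
    then show ?thesis by simp
  next
    case False
    then have "f -` (P1 \<inter> \<Inter>(weak_cylinder ` F)) \<inter> space M
        = (\<Inter>c\<in>F. f -` weak_cylinder c \<inter> space M)" using P1 by auto
    also have "\<dots> \<in> sets M"
      using False that cyl by (intro sets.finite_INT) (auto simp: \<F>_def)
    finally show ?thesis .
  qed
  ultimately have "(\<Union>F\<in>\<F>. f -` (P1 \<inter> \<Inter>(weak_cylinder ` F)) \<inter> space M) \<in> sets M"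
    by (intro sets.countable_UN') auto
  also have "(\<Union>F\<in>\<F>. f -` (P1 \<inter> \<Inter>(weak_cylinder ` F)) \<inter> space M) = f -` U \<inter> space M"
  proof (intro equalityI subsetI)
    fix x assume x: "x \<in> f -` U \<inter> space M"
    then obtain F where "F \<in> \<F>" "f x \<in> P1 \<inter> \<Inter>(weak_cylinder ` F)"
      using weak_cylinders_refine_open_set[OF U, of "f x"] by (auto simp: \<F>_def)
    then show "x \<in> (\<Union>F\<in>\<F>. f -` (P1 \<inter> \<Inter>(weak_cylinder ` F)) \<inter> space M)" using x by auto
  qed (auto simp: \<F>_def)
  finally show "f -` U \<inter> space M \<in> sets M" .
qed

section \<open>Monotone rearrangement of atomless measures on the unit interval\<close>

locale atomless_unit_measure = finite_borel_measure +
  assumes atomless: "measure M {x} = 0"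
    and null_outside: "measure M (- {0<..<1}) = 0"
begin

lemma isCont_cdf_atomless: "isCont (cdf M) x"
  by (simp add: isCont_cdf atomless)

lemma cdf_nonpos_eq_0:
  assumes "x \<le> 0"
  shows "cdf M x = 0"
proof -
  have "measure M {..x} \<le> measure M (- {0<..<1})"
    using assms by (intro finite_measure_mono) auto
  then show ?thesis using measure_nonneg[of M "{..x}"] by (simp add: cdf_def null_outside)
qed

lemma cdf_ge_1_eq_total:
  assumes "x \<ge> 1"
  shows "cdf M x = measure M UNIV"
proof -
  have "measure M (UNIV - {..x}) \<le> measure M (- {0<..<1})"
    using assms by (intro finite_measure_mono) auto
  then have "measure M (UNIV - {..x}) = 0"
    using measure_nonneg[of M "UNIV - {..x}"] by (simp add: null_outside)
  then show ?thesis
    using finite_measure_compl[OF sets_M, of "{..x}"] by (simp add: cdf_def borel_UNIV)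
qed

lemma cdf_le_total: "cdf M x \<le> measure M UNIV"
  using cdf_bounded by (simp add: borel_UNIV)

lemma gen_inv_attained:
  assumes "w \<le> measure M UNIV"
  shows "gen_inv (cdf M) w \<in> {0..1}" "w \<le> cdf M (gen_inv (cdf M) w)"
proof -
  let ?S = "{r\<in>{0..1}. cdf M r \<ge> w}"
  have "closed ({0..1} \<inter> {r. w \<le> cdf M r})"
    by (intro closed_Int closed_Collect_le continuous_at_imp_continuous_on ballI
        isCont_cdf_atomless continuous_const) auto
  moreover have "{0..1} \<inter> {r. w \<le> cdf M r} = ?S" by auto
  ultimately have "closed ?S" by simp
  moreover have "1 \<in> ?S" using assms by (simp add: cdf_ge_1_eq_total)
  moreover have "bdd_below ?S" by (intro bdd_belowI[of _ 0]) auto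
  ultimately have "Inf ?S \<in> ?S" by (intro closed_contains_Inf) auto
  then show "gen_inv (cdf M) w \<in> {0..1}" "w \<le> cdf M (gen_inv (cdf M) w)"
    by (auto simp: gen_inv_def)
qed

lemma gen_inv_le_iff:
  assumes "w \<le> measure M UNIV" "c \<in> {0..1}"
  shows "gen_inv (cdf M) w \<le> c \<longleftrightarrow> w \<le> cdf M c"
proof
  assume "gen_inv (cdf M) w \<le> c"
  then show "w \<le> cdf M c"
    using gen_inv_attained(2)[OF assms(1)] cdf_nondecreasing order_trans by blast
next
  assume "w \<le> cdf M c"
  then show "gen_inv (cdf M) w \<le> c"
    unfolding gen_inv_def using assms(2) by (intro cInf_lower bdd_belowI[of _ 0]) auto
qed

lemma gen_inv_mono:
  assumes "w \<le> w'" "w' \<le> measure M UNIV"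
  shows "gen_inv (cdf M) w \<le> gen_inv (cdf M) w'"
  using assms gen_inv_attained[of w'] by (subst gen_inv_le_iff) auto

lemma cdf_intermediate_value:
  assumes "0 \<le> w" "w \<le> cdf M b" "0 \<le> b"
  obtains c where "0 \<le> c" "c \<le> b" "cdf M c = w"
  using IVT[of "cdf M" 0 w b] assms isCont_cdf_atomless by (auto simp: cdf_nonpos_eq_0)

lemma cdf_gen_inv:
  assumes "0 \<le> w" "w \<le> measure M UNIV"
  shows "cdf M (gen_inv (cdf M) w) = w"
proof -
  obtain c where c: "0 \<le> c" "c \<le> gen_inv (cdf M) w" "cdf M c = w"
    using cdf_intermediate_value[of w "gen_inv (cdf M) w"] assms gen_inv_attained[OF assms(2)] by auto
  then have "gen_inv (cdf M) w \<le> c"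
    using gen_inv_attained[OF assms(2)] assms by (subst gen_inv_le_iff) auto
  then show ?thesis using c by simp
qed

text \<open>
  The sublevel set is a closed half-line, and by continuity the distribution function takes exactly
  the value \<open>t\<close> at its end point.
\<close>

lemma measure_cdf_sublevel:
  assumes "0 \<le> t" "t \<le> measure M UNIV"
  shows "measure M {x. cdf M x \<le> t} = t"
proof (cases "t = measure M UNIV")
  case True
  then have "{x. cdf M x \<le> t} = UNIV" using cdf_le_total by auto
  then show ?thesis using True by simp
next
  case False
  let ?S = "{x. cdf M x \<le> t}"
  have bound: "x \<le> 1" if "x \<in> ?S" for x
    using that False assms cdf_ge_1_eq_total[of x] by (cases "x \<le> 1") auto
  have bdd: "bdd_above ?S" using bound by (intro bdd_aboveI[of _ 1]) auto
  have "closed ?S"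
    by (intro closed_Collect_le continuous_at_imp_continuous_on ballI
        isCont_cdf_atomless continuous_const)
  moreover have "0 \<in> ?S" using assms by (simp add: cdf_nonpos_eq_0)
  ultimately have Sup: "Sup ?S \<in> ?S" using bdd by (intro closed_contains_Sup) auto
  have "?S = {..Sup ?S}"
  proof (intro equalityI subsetI)
    show "x \<in> {..Sup ?S}" if "x \<in> ?S" for x using that bdd by (auto intro: cSup_upper)
    show "x \<in> ?S" if "x \<in> {..Sup ?S}" for x
      using that Sup cdf_nondecreasing[of x "Sup ?S"] by auto
  qed
  moreover obtain s where "cdf M s = t"
    using cdf_intermediate_value[of t 1] assms by (auto simp: cdf_ge_1_eq_total)
  then have "t \<le> cdf M (Sup ?S)"
    using bdd by (metis (mono_tags) cSup_upper cdf_nondecreasing mem_Collect_eq order_refl)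
  ultimately show ?thesis using Sup by (simp add: cdf_def)
qed

end

text \<open>
  Composing the distribution function of the source with the generalised inverse of that of the
  target is the monotone transport map: it stays below \<open>c\<close> exactly where \<open>cdf M \<le> cdf N c\<close>, and this
  sublevel set has mass \<open>cdf N c\<close>.
\<close>

lemma mono_monotone_rearrangement:
  assumes "atomless_unit_measure M" "atomless_unit_measure N" "measure M UNIV = measure N UNIV"
  shows "mono (\<lambda>x. gen_inv (cdf N) (cdf M x))"
proof -
  interpret M: atomless_unit_measure M by fact
  interpret N: atomless_unit_measure N by fact
  show ?thesis
    using M.cdf_nondecreasing M.cdf_le_total assms(3) by (auto intro!: monoI N.gen_inv_mono)
qed

lemma distr_monotone_rearrangement:
  assumes "atomless_unit_measure M" "atomless_unit_measure N" and total: "measure M UNIV = measure N UNIV"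
  shows "distr M borel (\<lambda>x. gen_inv (cdf N) (cdf M x)) = N"
proof (rule cdf_unique')
  interpret M: atomless_unit_measure M by fact
  interpret N: atomless_unit_measure N by fact
  let ?T = "\<lambda>x. gen_inv (cdf N) (cdf M x)"
  have T: "?T \<in> M \<rightarrow>\<^sub>M borel"
    using borel_measurable_mono[OF mono_monotone_rearrangement[OF assms]]
    by (simp add: measurable_cong_sets[OF M.M_is_borel refl])
  show "finite_borel_measure (distr M borel ?T)"
    using M.finite_measure_distr[OF T]
    by (simp add: finite_borel_measure_def finite_borel_measure_axioms_def)
  show "finite_borel_measure N" by unfold_locales
  show "cdf (distr M borel ?T) = cdf N"
  proof
    fix c
    have w: "cdf M x \<le> measure N UNIV" for x using M.cdf_le_total total by simp
    have T01: "0 \<le> ?T x" "?T x \<le> 1" for x using N.gen_inv_attained(1)[OF w, of x] by simp_all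
    have "cdf (distr M borel ?T) c = measure M {x. ?T x \<le> c}"
      unfolding cdf_def[of "distr M borel ?T"] by (subst measure_distr[OF T]) (auto simp: M.borel_UNIV vimage_def)
    also have "\<dots> = cdf N c"
    proof (cases "c \<in> {0..1}")
      case True
      then have "{x. ?T x \<le> c} = {x. cdf M x \<le> cdf N c}"
        using N.gen_inv_le_iff[OF w] by auto
      then show ?thesis
        using M.measure_cdf_sublevel[of "cdf N c"] N.cdf_nonneg N.cdf_le_total total by simp
    next
      case False
      then consider "c < 0" | "1 < c" by fastforce
      then show ?thesis
      proof cases
        case 1
        then have "{x. ?T x \<le> c} = {}"
          using T01(1) by (auto simp: not_le intro: less_le_trans)
        then show ?thesis using 1 by (simp add: N.cdf_nonpos_eq_0)
      next
        case 2
        then have "{x. ?T x \<le> c} = UNIV"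
          using T01(2) by (auto intro: order_trans less_imp_le)
        then show ?thesis using 2 total by (simp add: N.cdf_ge_1_eq_total)
      qed
    qed
    finally show "cdf (distr M borel ?T) c = cdf N c" .
  qed
qed

lemma (in atomless_unit_measure) AE_in_unit_interval: "AE x in M. x \<in> {0<..<1}"
proof -
  have "emeasure M (- {0<..<1}) = 0" by (simp add: emeasure_eq_measure null_outside)
  then have "- {0<..<1} \<in> null_sets M" by (intro null_setsI) auto
  then show ?thesis by (rule AE_not_in[THEN eventually_mono]) simp
qed

text \<open>
  The rearrangement of \<open>M\<close> into itself lies below the identity and has the same integral as the
  identity, so it is the identity almost everywhere.
\<close>

lemma (in atomless_unit_measure) AE_gen_inv_cdf: "AE x in M. gen_inv (cdf M) (cdf M x) = x"
proof -
  let ?T = "\<lambda>x. gen_inv (cdf M) (cdf M x)"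
  have M: "atomless_unit_measure M" by unfold_locales
  have T [measurable]: "?T \<in> borel_measurable M"
    using borel_measurable_mono[OF mono_monotone_rearrangement[OF M M refl]]
    by (simp add: measurable_cong_sets[OF M_is_borel refl])
  have id [measurable]: "(\<lambda>x. x) \<in> borel_measurable M"
    by (simp add: measurable_cong_sets[OF M_is_borel refl])
  have T01: "?T x \<in> {0..1}" for x using gen_inv_attained(1)[OF cdf_le_total] .
  have int: "integrable M (\<lambda>x. x)" "integrable M ?T"
  proof (rule integrable_const_bound[of _ 1])
    show "AE x in M. norm x \<le> 1" using AE_in_unit_interval by (rule eventually_mono) auto
  qed (use T01 in \<open>auto intro!: integrable_const_bound[of _ 1]\<close>)
  have "(\<integral>x. ?T x \<partial>M) = (\<integral>y. y \<partial>distr M borel ?T)"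
    by (rule integral_distr[symmetric]) auto
  then have eq: "(\<integral>x. x - ?T x \<partial>M) = 0"
    using int by (simp add: distr_monotone_rearrangement[OF M M refl])
  have "AE x in M. 0 \<le> x - ?T x"
    using AE_in_unit_interval by (rule eventually_mono) (use gen_inv_le_iff cdf_le_total in auto)
  then have "AE x in M. x - ?T x = 0"
    using eq int by (subst (asm) integral_nonneg_eq_0_iff_AE) auto
  then show ?thesis by (rule eventually_mono) simp
qed

section \<open>Densities on the unit interval\<close>

text \<open>
  The measure lives on the whole line, so that it has a distribution function; the indicator discards
  the values of \<open>h\<close> outside \<open>(0,1)\<close>.
\<close>

definition unit_density :: "(real \<Rightarrow> real) \<Rightarrow> real measure" where
  "unit_density h = density lborel (\<lambda>x. ennreal (indicator {0<..<1} x * h x))"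

lemma gen_inv_cong:
  assumes "\<And>r. r \<in> {0..1} \<Longrightarrow> \<Delta> r = \<Delta>' r"
  shows "gen_inv \<Delta> w = gen_inv \<Delta>' w"
  using assms by (auto simp: gen_inv_def intro!: arg_cong[where f=Inf])

lemma measurable_lam01_iff:
  fixes h :: "real \<Rightarrow> real"
  shows "h \<in> borel_measurable lam01 \<longleftrightarrow> (\<lambda>x. indicator {0<..<1} x * h x) \<in> borel_measurable borel"
  unfolding measurable_cong_sets[OF sets_lam01 refl]
  by (subst borel_measurable_restrict_space_iff) (auto simp: mult.commute)

lemma integrable_lam01_iff:
  fixes h :: "real \<Rightarrow> real"
  shows "integrable lam01 h \<longleftrightarrow> integrable lborel (\<lambda>x. indicator {0<..<1} x * h x)"
  unfolding lam01_def by (subst integrable_restrict_space) auto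

lemma integral_lam01:
  fixes h :: "real \<Rightarrow> real"
  shows "(\<integral>u. h u \<partial>lam01) = (\<integral>x. indicator {0<..<1} x * h x \<partial>lborel)"
  unfolding lam01_def by (subst integral_restrict_space) auto

lemma AE_lam01: "(AE u in lam01. P u) \<longleftrightarrow> (AE x in lborel. x \<in> {0<..<1} \<longrightarrow> P x)"
  unfolding lam01_def by (subst AE_restrict_space_iff) auto

lemma sets_unit_density [simp]: "sets (unit_density h) = sets borel"
  by (simp add: unit_density_def)

lemma space_unit_density [simp]: "space (unit_density h) = UNIV"
  by (simp add: unit_density_def)

context
  fixes h :: "real \<Rightarrow> real"
  assumes int: "integrable lam01 h" and nonneg: "\<forall>u\<in>{0<..<1}. 0 \<le> h u"
begin

lemma integrable_extension: "integrable lborel (\<lambda>x. indicator {0<..<1} x * h x)"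
  using int by (simp add: integrable_lam01_iff)

lemma measurable_extension [measurable]: "(\<lambda>x. indicator {0<..<1} x * h x) \<in> borel_measurable borel"
  using int measurable_lam01_iff[of h] borel_measurable_integrable by blast

lemma nonneg_extension: "0 \<le> indicator {0<..<1} x * h x"
  using nonneg by (auto split: split_indicator)

lemma emeasure_unit_density:
  assumes "A \<in> sets borel"
  shows "emeasure (unit_density h) A = ennreal (\<integral>x. indicator A x * (indicator {0<..<1} x * h x) \<partial>lborel)"
proof -
  have "emeasure (unit_density h) A
      = (\<integral>\<^sup>+x. ennreal (indicator {0<..<1} x * h x) * indicator A x \<partial>lborel)"
    unfolding unit_density_def using assms by (subst emeasure_density) auto
  also have "\<dots> = (\<integral>\<^sup>+x. ennreal (indicator A x * (indicator {0<..<1} x * h x)) \<partial>lborel)"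
    by (intro nn_integral_cong) (auto split: split_indicator)
  also have "\<dots> = ennreal (\<integral>x. indicator A x * (indicator {0<..<1} x * h x) \<partial>lborel)"
    using integrable_real_mult_indicator[OF _ integrable_extension, of A] assms nonneg_extension
    by (intro nn_integral_eq_integral) (auto simp: mult.commute split: split_indicator)
  finally show ?thesis .
qed

lemma measure_unit_density:
  assumes "A \<in> sets borel"
  shows "measure (unit_density h) A = (\<integral>x. indicator A x * (indicator {0<..<1} x * h x) \<partial>lborel)"
  unfolding measure_def using emeasure_unit_density[OF assms] nonneg_extension
  by (simp add: integral_nonneg_AE)

lemma atomless_unit_density: "atomless_unit_measure (unit_density h)"
proof (intro atomless_unit_measure.intro finite_borel_measure.intro finite_measureI
    finite_borel_measure_axioms.intro atomless_unit_measure_axioms.intro)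
  show "emeasure (unit_density h) (space (unit_density h)) \<noteq> \<infinity>"
    by (simp add: emeasure_unit_density)
  show "sets (unit_density h) = sets borel" by simp
  show "measure (unit_density h) {x} = 0" for x
  proof -
    have "AE y in lborel. indicator {x} y * (indicator {0<..<1} y * h y) = 0"
      using AE_lborel_singleton[of x] by (rule eventually_mono) auto
    then show ?thesis by (simp add: measure_unit_density integral_eq_zero_AE)
  qed
  show "measure (unit_density h) (- {0<..<1}) = 0"
    by (simp add: measure_unit_density flip: mult.assoc indicator_inter_arith)
qed

lemma total_unit_density: "measure (unit_density h) UNIV = (\<integral>u. h u \<partial>lam01)"
  by (simp add: measure_unit_density integral_lam01)

lemma cdf_unit_density:
  assumes "u \<in> {0..1}"
  shows "cdf (unit_density h) u = (LBINT v:{0<..<u}. h v)"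
proof -
  have "cdf (unit_density h) u = (\<integral>x. indicator {..u} x * (indicator {0<..<1} x * h x) \<partial>lborel)"
    unfolding cdf_def by (rule measure_unit_density) simp
  also have "\<dots> = (\<integral>x. indicator {0<..<u} x *\<^sub>R h x \<partial>lborel)"
  proof (rule integral_cong_AE)
    have "(\<lambda>x. indicator {0<..<u} x * (indicator {0<..<1} x * h x)) \<in> borel_measurable borel"
      by measurable
    moreover have "indicator {0<..<u} x * (indicator {0<..<1} x * h x) = indicator {0<..<u} x * h x" for x
      using assms by (auto split: split_indicator)
    ultimately show "(\<lambda>x. indicator {0<..<u} x *\<^sub>R h x) \<in> borel_measurable lborel" by simp
    show "AE x in lborel. indicator {..u} x * (indicator {0<..<1} x * h x) = indicator {0<..<u} x *\<^sub>R h x"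
      using AE_lborel_singleton[of u] AE_lborel_singleton[of 1]
      by eventually_elim (use assms in \<open>auto split: split_indicator\<close>)
  qed simp
  finally show ?thesis by (simp add: set_lebesgue_integral_def)
qed

lemma AE_unit_density: "(AE x in unit_density h. P x) \<longleftrightarrow> (AE u in lam01. 0 < h u \<longrightarrow> P u)"
  unfolding unit_density_def AE_lam01
  by (subst AE_density) (auto simp: zero_less_mult_iff split: split_indicator intro!: AE_cong)

lemma integral_unit_density:
  assumes k: "k \<in> borel_measurable lam01"
  shows "(\<integral>x. indicator {0<..<1} x * k x \<partial>unit_density h) = (\<integral>u. h u * k u \<partial>lam01)"
proof -
  have [measurable]: "(\<lambda>x. indicator {0<..<1} x * k x) \<in> borel_measurable borel"
    using k measurable_lam01_iff by blast
  have "(\<integral>x. indicator {0<..<1} x * k x \<partial>unit_density h)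
      = (\<integral>x. (indicator {0<..<1} x * h x) *\<^sub>R (indicator {0<..<1} x * k x) \<partial>lborel)"
    unfolding unit_density_def using nonneg_extension by (intro integral_density) auto
  also have "\<dots> = (\<integral>u. h u * k u \<partial>lam01)"
    unfolding integral_lam01
    by (intro Bochner_Integration.integral_cong) (auto split: split_indicator)
  finally show ?thesis .
qed

end

text \<open>
  Rearranging \<open>f\<close> into \<open>g\<close> and then \<open>g\<close> into \<open>f\<close> gives the rearrangement of \<open>f\<close> into itself,
  because an atomless distribution function undoes its generalised inverse on all values up to the
  total mass.
  This makes \<open>phi\<close> an almost everywhere defined involution.
\<close>

context
  fixes f g :: "real \<Rightarrow> real"
  assumes f: "integrable lam01 f" "\<forall>u\<in>{0<..<1}. 0 \<le> f u"
    and g: "integrable lam01 g" "\<forall>u\<in>{0<..<1}. 0 \<le> g u"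
    and total: "(\<integral>u. f u \<partial>lam01) = (\<integral>u. g u \<partial>lam01)"
begin

interpretation F: atomless_unit_measure "unit_density f" by (rule atomless_unit_density[OF f])
interpretation G: atomless_unit_measure "unit_density g" by (rule atomless_unit_density[OF g])

abbreviation (input) "rearrange u \<equiv> gen_inv (cdf (unit_density g)) (cdf (unit_density f) u)"

lemma unit_density_total_eq: "measure (unit_density f) UNIV = measure (unit_density g) UNIV"
  by (simp add: total_unit_density[OF f] total_unit_density[OF g] total)

lemma measurable_density_rearrangement: "rearrange \<in> borel_measurable borel"
  by (rule borel_measurable_mono[OF mono_monotone_rearrangement[OF F.atomless_unit_measure_axioms
        G.atomless_unit_measure_axioms unit_density_total_eq]])

lemma distr_density_rearrangement: "distr (unit_density f) borel rearrange = unit_density g"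
  by (rule distr_monotone_rearrangement[OF F.atomless_unit_measure_axioms
        G.atomless_unit_measure_axioms unit_density_total_eq])

lemma AE_density_rearrangement:
  "AE u in lam01. 0 < f u \<longrightarrow> rearrange u \<in> {0<..<1} \<and> 0 < g (rearrange u)
     \<and> gen_inv (cdf (unit_density f)) (cdf (unit_density g) (rearrange u)) = u"
proof -
  have "AE v in unit_density g. v \<in> {0<..<1} \<and> 0 < g v"
    unfolding AE_unit_density[OF g] by (rule AE_I2) auto
  moreover have "rearrange \<in> unit_density f \<rightarrow>\<^sub>M borel"
    using measurable_density_rearrangement by (simp only: measurable_cong_sets[OF sets_unit_density refl])
  ultimately have "AE u in unit_density f. rearrange u \<in> {0<..<1} \<and> 0 < g (rearrange u)"
    using AE_distrD[of rearrange "unit_density f" borel "\<lambda>v. v \<in> {0<..<1} \<and> 0 < g v",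
        unfolded distr_density_rearrangement] by blast
  moreover have "cdf (unit_density g) (rearrange u) = cdf (unit_density f) u" for u
    using F.cdf_nonneg F.cdf_le_total by (intro G.cdf_gen_inv) (simp_all only: unit_density_total_eq)
  then have "AE u in unit_density f.
      gen_inv (cdf (unit_density f)) (cdf (unit_density g) (rearrange u)) = u"
    using F.AE_gen_inv_cdf by (simp only:)
  ultimately have "AE u in unit_density f. rearrange u \<in> {0<..<1} \<and> 0 < g (rearrange u)
     \<and> gen_inv (cdf (unit_density f)) (cdf (unit_density g) (rearrange u)) = u"
    by eventually_elim simp
  then show ?thesis unfolding AE_unit_density[OF f] .
qed

text \<open>The indicator extends \<open>k\<close>, which is measurable on \<open>(0,1)\<close> only, to the whole line.\<close>

lemma integral_density_rearrangement:
  fixes k :: "real \<Rightarrow> real"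
  assumes k: "k \<in> borel_measurable lam01"
  shows "(\<integral>v. g v * k v \<partial>lam01)
    = (\<integral>u. f u * (indicator {0<..<1} (rearrange u) * k (rearrange u)) \<partial>lam01)"
proof -
  note [measurable] = measurable_density_rearrangement
  have k' [measurable]: "(\<lambda>x. indicator {0<..<1} x * k x) \<in> borel_measurable borel"
    using k measurable_lam01_iff by blast
  let ?k = "\<lambda>u. indicator {0<..<1} (rearrange u) * k (rearrange u)"
  have "?k \<in> borel_measurable borel"
    by (rule measurable_compose[OF measurable_density_rearrangement k'])
  then have k'': "?k \<in> borel_measurable lam01"
    by (simp add: measurable_cong_sets[OF sets_lam01 refl] measurable_restrict_space1)
  have "(\<integral>v. g v * k v \<partial>lam01) = (\<integral>x. indicator {0<..<1} x * k x \<partial>distr (unit_density f) borel rearrange)"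
    by (simp add: distr_density_rearrangement integral_unit_density[OF g k])
  also have "\<dots> = (\<integral>u. ?k u \<partial>unit_density f)"
    by (rule integral_distr) (auto simp: measurable_cong_sets[OF sets_unit_density refl])
  also have "\<dots> = (\<integral>u. indicator {0<..<1} u * ?k u \<partial>unit_density f)"
  proof (rule integral_cong_AE)
    show "AE u in unit_density f. ?k u = indicator {0<..<1} u * ?k u"
      using F.AE_in_unit_interval by (rule eventually_mono) simp
    show m: "?k \<in> borel_measurable (unit_density f)"
      using \<open>?k \<in> borel_measurable borel\<close> by (simp only: measurable_cong_sets[OF sets_unit_density refl])
    show "(\<lambda>u. indicator {0<..<1} u * ?k u) \<in> borel_measurable (unit_density f)"
      by (rule borel_measurable_times[OF borel_measurable_indicator m]) simp
  qed
  also have "\<dots> = (\<integral>u. f u * ?k u \<partial>lam01)"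
    by (rule integral_unit_density[OF f k''])
  finally show ?thesis .
qed

end

section \<open>Barycentres of a dispersed coupling\<close>

lemma ext_integral_eq_integral:
  assumes "integrable M f"
  shows "ext_integral M f = ereal (\<integral>x. f x \<partial>M)"
proof -
  have "(\<integral>\<^sup>+x. ennreal (f x) \<partial>M) < \<infinity>" "(\<integral>\<^sup>+x. ennreal (- f x) \<partial>M) < \<infinity>"
    using assms real_integrable_def[of M f] by (auto simp: less_top)
  then obtain a b where "(\<integral>\<^sup>+x. ennreal (f x) \<partial>M) = ennreal a" "0 \<le> a"
    "(\<integral>\<^sup>+x. ennreal (- f x) \<partial>M) = ennreal b" "0 \<le> b"
    by (metis ennreal_cases infinity_ennreal_def less_irrefl)
  then show ?thesis
    using real_lebesgue_integral_def[OF assms] by (simp add: ext_integral_def)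
qed

lemma cx_le_imp_mean_eq:
  assumes "\<mu> \<in> P1" "\<nu> \<in> P1" "cx_le \<mu> \<nu>"
  shows "mean \<mu> = mean \<nu>"
proof -
  have "convex_on UNIV (\<lambda>x :: real. x)" "convex_on UNIV (\<lambda>x :: real. - x)"
    by (auto simp: convex_on_def algebra_simps)
  then have "ext_integral \<mu> (\<lambda>x. x) \<le> ext_integral \<nu> (\<lambda>x. x)"
    "ext_integral \<mu> (\<lambda>x. - x) \<le> ext_integral \<nu> (\<lambda>x. - x)"
    using assms(3) by (auto simp: cx_le_def)
  then show ?thesis
    using P1_D(4)[OF assms(1)] P1_D(4)[OF assms(2)] by (simp add: ext_integral_eq_integral mean_def)
qed

lemma second_marginal_disintegration:
  assumes \<mu>: "\<mu> \<in> P1" and \<nu>: "\<nu> \<in> P1" and \<pi>: "\<pi> \<in> couplings \<mu> \<nu>" "disintegration \<mu> \<pi> \<kappa>"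
  shows "\<mu> \<bind> \<kappa> = \<nu>"
proof -
  have \<kappa>: "\<kappa> \<in> borel \<rightarrow>\<^sub>M prob_algebra borel" "\<And>x. \<kappa> x \<in> P1"
    and eq: "\<pi> = \<mu> \<bind> (\<lambda>x. \<kappa> x \<bind> (\<lambda>y. return (borel \<Otimes>\<^sub>M borel) (x, y)))"
    using \<pi>(2) by (auto simp: disintegration_def)
  note [measurable] = \<kappa>(1)
  have "(\<lambda>x. \<kappa> x \<bind> (\<lambda>y. return (borel \<Otimes>\<^sub>M borel) (x, y))) \<in> borel \<rightarrow>\<^sub>M prob_algebra (borel \<Otimes>\<^sub>M borel)"
    by (intro measurable_bind_prob_space2[where N=borel] \<kappa>) measurable
  then have fibre: "(\<lambda>x. \<kappa> x \<bind> (\<lambda>y. return (borel \<Otimes>\<^sub>M borel) (x, y)))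
      \<in> \<mu> \<rightarrow>\<^sub>M subprob_algebra (borel \<Otimes>\<^sub>M borel)"
    unfolding measurable_cong_sets[OF P1_D(2)[OF \<mu>] refl] by (rule measurable_prob_algebraD)
  have "\<nu> = distr \<pi> \<nu> snd" using \<pi>(1) by (simp add: couplings_def)
  also have "\<dots> = distr \<pi> borel snd" by (intro distr_cong P1_D(2)[OF \<nu>]) auto
  also have "\<dots> = \<mu> \<bind> (\<lambda>x. distr (\<kappa> x \<bind> (\<lambda>y. return (borel \<Otimes>\<^sub>M borel) (x, y))) borel snd)"
    unfolding eq using P1_D(3)[OF \<mu>] by (intro distr_bind[OF fibre]) auto
  also have "\<dots> = \<mu> \<bind> \<kappa>"
  proof (rule bind_cong[OF refl])
    fix x
    have m: "(\<lambda>y. (x, y)) \<in> \<kappa> x \<rightarrow>\<^sub>M borel \<Otimes>\<^sub>M borel"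
      unfolding measurable_cong_sets[OF P1_D(2)[OF \<kappa>(2)] refl] by measurable
    then have "\<kappa> x \<bind> (\<lambda>y. return (borel \<Otimes>\<^sub>M borel) (x, y)) = distr (\<kappa> x) (borel \<Otimes>\<^sub>M borel) (\<lambda>y. (x, y))"
      using P1_D(3)[OF \<kappa>(2)] by (intro bind_return_distr') auto
    then have "distr (\<kappa> x \<bind> (\<lambda>y. return (borel \<Otimes>\<^sub>M borel) (x, y))) borel snd
        = distr (\<kappa> x) borel (\<lambda>y. y)"
      using m by (simp add: distr_distr comp_def)
    also have "\<dots> = \<kappa> x" by (rule distr_id2) (simp add: P1_D(2)[OF \<kappa>(2)])
    finally show "distr (\<kappa> x \<bind> (\<lambda>y. return (borel \<Otimes>\<^sub>M borel) (x, y))) borel snd = \<kappa> x" .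
  qed
  finally show ?thesis by simp
qed

text \<open>
  The positive and the negative part of the mean are integrals of nonnegative functions, for which
  the mixture formula holds in \<open>[0, \<infinity>]\<close>; membership of the mixture in \<^const>\<open>P1\<close> makes both
  of them finite.
\<close>

lemma
  assumes M: "sets M = sets borel" "space M \<noteq> {}"
    and K: "K \<in> M \<rightarrow>\<^sub>M prob_algebra borel" "\<And>x. K x \<in> P1" and bind: "M \<bind> K \<in> P1"
  shows integrable_mean_bind: "integrable M (\<lambda>x. mean (K x))"
    and integral_mean_bind: "(\<integral>x. mean (K x) \<partial>M) = mean (M \<bind> K)"
proof -
  note K' [measurable] = measurable_prob_algebraD[OF K(1)]
  have part: "integrable M (\<lambda>x. enn2real (\<integral>\<^sup>+y. ennreal (s y) \<partial>K x))
      \<and> (\<integral>x. enn2real (\<integral>\<^sup>+y. ennreal (s y) \<partial>K x) \<partial>M) = enn2real (\<integral>\<^sup>+y. ennreal (s y) \<partial>(M \<bind> K))"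
    if s: "s = (\<lambda>y. y) \<or> s = (\<lambda>y :: real. - y)" for s
  proof -
    have [measurable]: "s \<in> borel_measurable borel" using s by auto
    have fin: "(\<integral>\<^sup>+y. ennreal (s y) \<partial>\<eta>) < top" if "\<eta> \<in> P1" for \<eta>
      using P1_D(4)[OF that] s real_integrable_def[of \<eta> "\<lambda>y. y"] by (auto simp: less_top)
    have m [measurable]: "(\<lambda>x. \<integral>\<^sup>+y. ennreal (s y) \<partial>K x) \<in> borel_measurable M"
      by (rule measurable_compose[OF K' nn_integral_measurable_subprob_algebra]) simp
    have eq: "(\<integral>\<^sup>+x. ennreal (enn2real (\<integral>\<^sup>+y. ennreal (s y) \<partial>K x)) \<partial>M) = (\<integral>\<^sup>+y. ennreal (s y) \<partial>(M \<bind> K))"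
      using fin[OF K(2)] by (subst nn_integral_bind[OF _ K']) auto
    then show ?thesis
      using fin[OF bind]
      by (auto intro!: integrableI_nonneg simp: integral_eq_nn_integral enn2real_nonneg)
  qed
  have mean: "mean \<eta> = enn2real (\<integral>\<^sup>+y. ennreal y \<partial>\<eta>) - enn2real (\<integral>\<^sup>+y. ennreal (- y) \<partial>\<eta>)"
    if "\<eta> \<in> P1" for \<eta>
    unfolding mean_def by (rule real_lebesgue_integral_def[OF P1_D(4)[OF that]])
  show "integrable M (\<lambda>x. mean (K x))" "(\<integral>x. mean (K x) \<partial>M) = mean (M \<bind> K)"
    using part[of "\<lambda>y. y"] part[of "\<lambda>y. - y"] by (auto simp: mean[OF K(2)] mean[OF bind])
qed

locale dispersed_coupling =
  fixes \<mu> \<nu> :: "real measure" and \<kappa> :: "real \<Rightarrow> real measure"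
  assumes \<mu>: "\<mu> \<in> P1" and \<nu>: "\<nu> \<in> P1"
    and \<kappa>: "\<kappa> \<in> borel \<rightarrow>\<^sub>M prob_algebra borel" and \<kappa>_P1: "\<kappa> x \<in> P1"
    and second_marginal: "\<mu> \<bind> \<kappa> = \<nu>"
    and mean_eq: "mean \<mu> = mean \<nu>"
    and dispersion: "barycentre_dispersion \<mu> \<kappa>"
begin

abbreviation "Q \<equiv> quantile \<mu>"
abbreviation "G \<equiv> bary \<mu> \<kappa>"

definition excess :: "real \<Rightarrow> real" where
  "excess u = max 0 (Q u - G u)"

definition deficit :: "real \<Rightarrow> real" where
  "deficit u = max 0 (- (Q u - G u))"

lemma measurable_Q [measurable]: "Q \<in> borel_measurable lam01"
  by (rule measurable_quantile[OF \<mu>])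

lemma measurable_kernel [measurable]: "(\<lambda>u. \<kappa> (Q u)) \<in> lam01 \<rightarrow>\<^sub>M prob_algebra borel"
  by (rule measurable_compose[OF measurable_Q \<kappa>])

lemma kernel_marginal: "lam01 \<bind> (\<lambda>u. \<kappa> (Q u)) = \<nu>"
  using bind_distr[OF measurable_Q measurable_prob_algebraD[OF \<kappa>]]
  by (simp add: distr_quantile[OF \<mu>] second_marginal)

lemma integrable_mean_kernel: "integrable \<mu> (\<lambda>x. mean (\<kappa> x))"
  and integral_mean_kernel: "(\<integral>x. mean (\<kappa> x) \<partial>\<mu>) = mean \<mu>"
proof -
  have "\<kappa> \<in> \<mu> \<rightarrow>\<^sub>M prob_algebra borel"
    unfolding measurable_cong_sets[OF P1_D(2)[OF \<mu>] refl] by (rule \<kappa>)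
  note mean_bind = P1_D(2)[OF \<mu>] _ this \<kappa>_P1
  show "integrable \<mu> (\<lambda>x. mean (\<kappa> x))" "(\<integral>x. mean (\<kappa> x) \<partial>\<mu>) = mean \<mu>"
    using integrable_mean_bind[OF mean_bind] integral_mean_bind[OF mean_bind] P1_D(3)[OF \<mu>] \<nu>
    by (simp_all add: second_marginal mean_eq)
qed

lemma measurable_mean_kernel [measurable]: "(\<lambda>x. mean (\<kappa> x)) \<in> borel_measurable borel"
  using borel_measurable_integrable[OF integrable_mean_kernel]
  by (simp only: measurable_cong_sets[OF P1_D(2)[OF \<mu>] refl])

lemma integrable_Q: "integrable lam01 Q"
  by (rule integrable_quantile[OF \<mu>])

lemma integrable_G: "integrable lam01 G"
  using integrable_distr[OF measurable_Q, of "\<lambda>x. mean (\<kappa> x)"] integrable_mean_kernel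
  unfolding distr_quantile[OF \<mu>] bary_def[abs_def] by blast

lemma measurable_G [measurable]: "G \<in> borel_measurable lam01"
  by (rule borel_measurable_integrable[OF integrable_G])

lemma integral_defect: "(\<integral>u. Q u - G u \<partial>lam01) = 0"
proof -
  have "(\<integral>u. G u \<partial>lam01) = mean \<mu>"
    using integral_distr[OF measurable_Q, of "\<lambda>x. mean (\<kappa> x)"] integral_mean_kernel
    unfolding distr_quantile[OF \<mu>] bary_def[abs_def] by simp
  then show ?thesis using integrable_Q integrable_G integral_quantile[OF \<mu>] by simp
qed

lemma dispersion_closed_ray: "(\<integral>u. indicator {a..} (Q u) * (Q u - G u) \<partial>lam01) \<le> 0"
proof -
  have "(\<integral>x. indicator {a..} x * (x - mean (\<kappa> x)) \<partial>distr lam01 borel Q)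
      = (\<integral>u. indicator {a..} (Q u) * (Q u - mean (\<kappa> (Q u))) \<partial>lam01)"
    by (rule integral_distr) auto
  then show ?thesis
    using dispersion[unfolded barycentre_dispersion_def, rule_format, of a]
    unfolding distr_quantile[OF \<mu>] bary_def by linarith
qed

lemma integrable_defect_indicator:
  assumes [measurable]: "Measurable.pred lam01 P"
  shows "integrable lam01 (\<lambda>u. of_bool (P u) * (Q u - G u))"
  by (rule Bochner_Integration.integrable_bound[of _ "\<lambda>u. Q u - G u"])
    (use integrable_Q integrable_G in \<open>auto simp: of_bool_def\<close>)

lemma dispersion_open_ray: "(\<integral>u. indicator {a<..} (Q u) * (Q u - G u) \<partial>lam01) \<le> 0"
proof (rule LIMSEQ_le_const2)
  let ?s = "\<lambda>n u. indicator {a + 1 / real (Suc n)..} (Q u) * (Q u - G u)"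
  show "(\<lambda>n. \<integral>u. ?s n u \<partial>lam01) \<longlonglongrightarrow> (\<integral>u. indicator {a<..} (Q u) * (Q u - G u) \<partial>lam01)"
  proof (rule integral_dominated_convergence[where w="\<lambda>u. \<bar>Q u - G u\<bar>"])
    show "AE u in lam01. (\<lambda>n. ?s n u) \<longlonglongrightarrow> indicator {a<..} (Q u) * (Q u - G u)"
    proof (intro AE_I2 tendsto_mult tendsto_const)
      fix u
      show "(\<lambda>n. indicator {a + 1 / real (Suc n)..} (Q u) :: real) \<longlonglongrightarrow> indicator {a<..} (Q u)"
      proof (cases "a < Q u")
        case True
        have "(\<lambda>n. a + 1 / real (Suc n)) \<longlonglongrightarrow> a + 0"
          by (intro tendsto_add tendsto_const LIMSEQ_Suc[OF lim_1_over_n])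
        then have "eventually (\<lambda>n. a + 1 / real (Suc n) < Q u) sequentially"
          using True by (intro order_tendstoD) auto
        then have "eventually (\<lambda>n. indicator {a + 1 / real (Suc n)..} (Q u) = (1 :: real)) sequentially"
          by (rule eventually_mono) simp
        then show ?thesis using True by (simp add: tendsto_eventually)
      next
        case False
        have "Q u < a + 1 / real (Suc n)" for n
          by (rule le_less_trans[of _ a]) (use False in auto)
        then have "indicator {a + 1 / real (Suc n)..} (Q u) = (0 :: real)" for n
          by (meson atLeast_iff indicator_simps(2) not_le)
        then show ?thesis using False by simp
      qed
    qed
    show "AE u in lam01. norm (?s n u) \<le> \<bar>Q u - G u\<bar>" for n
      by (auto simp: indicator_def)
  qed (use integrable_Q integrable_G in auto)
  show "\<exists>N. \<forall>n\<ge>N. (\<integral>u. ?s n u \<partial>lam01) \<le> 0"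
    using dispersion_closed_ray by blast
qed

text \<open>
  On a level set \<open>{Q = a}\<close> the defect \<open>Q - G\<close> has the constant value \<open>c = a - mean (\<kappa> a)\<close>. The ray
  \<open>{v > u}\<close> arises from \<open>{Q \<ge> Q u}\<close> by removing, and from \<open>{Q > Q u}\<close> by adding, a part of the
  level set of \<open>Q u\<close>; according to the sign of \<open>c\<close>, one of the two changes preserves nonpositivity.
\<close>

lemma tail_defect_nonpos:
  assumes u: "u \<in> {0<..<1}"
  shows "(\<integral>v. of_bool (u < v) * (Q v - G v) \<partial>lam01) \<le> 0"
proof -
  let ?a = "Q u" and ?d = "\<lambda>v. Q v - G v"
  let ?c = "Q u - mean (\<kappa> (Q u))"
  note [measurable] = measurable_ident_lam01
  have mono: "Q v \<le> Q w" if "v \<in> {0<..<1}" "w \<in> {0<..<1}" "v \<le> w" for v w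
    using mono_onD[OF mono_on_quantile[OF \<mu>]] that by blast
  have level: "(\<integral>v. of_bool (P v \<and> Q v = ?a) * ?d v \<partial>lam01) = ?c * measure lam01 {v\<in>space lam01. P v \<and> Q v = ?a}"
    if [measurable]: "Measurable.pred lam01 P" for P
  proof -
    have "(\<integral>v. of_bool (P v \<and> Q v = ?a) * ?d v \<partial>lam01)
        = (\<integral>v. ?c * indicator {v\<in>space lam01. P v \<and> Q v = ?a} v \<partial>lam01)"
      by (intro Bochner_Integration.integral_cong) (auto simp: bary_def split: split_indicator)
    also have "\<dots> = ?c * measure lam01 {v\<in>space lam01. P v \<and> Q v = ?a}"
    proof -
      have "{v\<in>space lam01. P v \<and> Q v = ?a} \<inter> space lam01 = {v\<in>space lam01. P v \<and> Q v = ?a}" by auto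
      then show ?thesis by (simp del: space_lam01)
    qed
    finally show ?thesis .
  qed
  have "(\<integral>v. of_bool (u < v) * ?d v \<partial>lam01)
      = (\<integral>v. of_bool (?a \<le> Q v) * ?d v - of_bool (v \<le> u \<and> Q v = ?a) * ?d v \<partial>lam01)"
    using u mono by (intro Bochner_Integration.integral_cong) (auto simp: not_less of_bool_def intro: antisym)
  also have "\<dots> = (\<integral>v. of_bool (?a \<le> Q v) * ?d v \<partial>lam01)
      - ?c * measure lam01 {v\<in>space lam01. v \<le> u \<and> Q v = ?a}"
  proof -
    have "integrable lam01 (\<lambda>v. of_bool (?a \<le> Q v) * ?d v)"
      "integrable lam01 (\<lambda>v. of_bool (v \<le> u \<and> Q v = ?a) * ?d v)"
      by (rule integrable_defect_indicator, measurable)+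
    moreover have "Measurable.pred lam01 (\<lambda>v. v \<le> u)" by measurable
    ultimately show ?thesis by (simp only: Bochner_Integration.integral_diff level)
  qed
  also have "(\<integral>v. of_bool (?a \<le> Q v) * ?d v \<partial>lam01) = (\<integral>v. indicator {?a..} (Q v) * ?d v \<partial>lam01)"
    by (intro Bochner_Integration.integral_cong) (auto simp: indicator_def)
  finally have closed_ray: "(\<integral>v. of_bool (u < v) * ?d v \<partial>lam01) = (\<integral>v. indicator {?a..} (Q v) * ?d v \<partial>lam01)
      - ?c * measure lam01 {v\<in>space lam01. v \<le> u \<and> Q v = ?a}" .
  have "(\<integral>v. of_bool (u < v) * ?d v \<partial>lam01)
      = (\<integral>v. of_bool (?a < Q v) * ?d v + of_bool (u < v \<and> Q v = ?a) * ?d v \<partial>lam01)"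
  proof (intro Bochner_Integration.integral_cong refl)
    fix v assume "v \<in> space lam01"
    then have "u < v \<Longrightarrow> ?a \<le> Q v" "\<not> u < v \<Longrightarrow> Q v \<le> ?a" using u mono by auto
    then show "of_bool (u < v) * ?d v
        = of_bool (?a < Q v) * ?d v + of_bool (u < v \<and> Q v = ?a) * ?d v"
      by (cases "u < v") auto
  qed
  also have "\<dots> = (\<integral>v. of_bool (?a < Q v) * ?d v \<partial>lam01)
      + ?c * measure lam01 {v\<in>space lam01. u < v \<and> Q v = ?a}"
  proof -
    have "integrable lam01 (\<lambda>v. of_bool (?a < Q v) * ?d v)"
      "integrable lam01 (\<lambda>v. of_bool (u < v \<and> Q v = ?a) * ?d v)"
      by (rule integrable_defect_indicator, measurable)+
    moreover have "Measurable.pred lam01 (\<lambda>v. u < v)" by measurable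
    ultimately show ?thesis by (simp only: Bochner_Integration.integral_add level)
  qed
  also have "(\<integral>v. of_bool (?a < Q v) * ?d v \<partial>lam01) = (\<integral>v. indicator {?a<..} (Q v) * ?d v \<partial>lam01)"
    by (intro Bochner_Integration.integral_cong) (auto simp: indicator_def)
  finally have open_ray: "(\<integral>v. of_bool (u < v) * ?d v \<partial>lam01) = (\<integral>v. indicator {?a<..} (Q v) * ?d v \<partial>lam01)
      + ?c * measure lam01 {v\<in>space lam01. u < v \<and> Q v = ?a}" .
  show ?thesis
  proof (cases "?c \<ge> 0")
    case True
    then have "0 \<le> ?c * measure lam01 {v\<in>space lam01. v \<le> u \<and> Q v = ?a}" by simp
    then show ?thesis using closed_ray dispersion_closed_ray[of ?a] by linarith
  next
    case False
    then have "?c * measure lam01 {v\<in>space lam01. u < v \<and> Q v = ?a} \<le> 0"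
      by (intro mult_nonpos_nonneg) auto
    then show ?thesis using open_ray dispersion_open_ray[of ?a] by linarith
  qed
qed

lemma excess_facts: "integrable lam01 excess" "\<forall>u\<in>{0<..<1}. 0 \<le> excess u"
  and deficit_facts: "integrable lam01 deficit" "\<forall>u\<in>{0<..<1}. 0 \<le> deficit u"
  using integrable_Q integrable_G by (auto simp: excess_def[abs_def] deficit_def[abs_def])

lemma excess_minus_deficit: "excess u - deficit u = Q u - G u"
  by (simp add: excess_def deficit_def)

lemma total_excess_eq_deficit: "(\<integral>u. excess u \<partial>lam01) = (\<integral>u. deficit u \<partial>lam01)"
proof -
  have "(\<integral>u. excess u - deficit u \<partial>lam01) = 0" by (simp add: excess_minus_deficit integral_defect)
  then show ?thesis using excess_facts deficit_facts by simp
qed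

sublocale E: atomless_unit_measure "unit_density excess"
  by (rule atomless_unit_density[OF excess_facts])

sublocale D: atomless_unit_measure "unit_density deficit"
  by (rule atomless_unit_density[OF deficit_facts])

lemma unit_density_totals: "measure (unit_density excess) UNIV = measure (unit_density deficit) UNIV"
  by (rule unit_density_total_eq[OF excess_facts deficit_facts total_excess_eq_deficit])

lemma Delta_plus_eq_cdf: "u \<in> {0..1} \<Longrightarrow> Delta_plus \<mu> \<kappa> u = cdf (unit_density excess) u"
  and Delta_minus_eq_cdf: "u \<in> {0..1} \<Longrightarrow> Delta_minus \<mu> \<kappa> u = cdf (unit_density deficit) u"
  using cdf_unit_density[OF excess_facts] cdf_unit_density[OF deficit_facts]
  by (simp_all add: Delta_plus_def Delta_minus_def excess_def[abs_def] deficit_def[abs_def])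

lemma Delta_minus_le_Delta_plus:
  assumes u: "u \<in> {0<..<1}"
  shows "cdf (unit_density deficit) u \<le> cdf (unit_density excess) u"
proof -
  note [measurable] = measurable_ident_lam01
  have cdf: "cdf (unit_density h) u = (\<integral>v. of_bool (v \<le> u) * h v \<partial>lam01)"
    if "integrable lam01 h" "\<forall>u\<in>{0<..<1}. 0 \<le> h u" for h
    unfolding cdf_def measure_unit_density[OF that, of "{..u}", simplified] integral_lam01
    by (intro Bochner_Integration.integral_cong) (auto simp: indicator_def)
  have int: "integrable lam01 (\<lambda>v. of_bool (v \<le> u) * h v)" if "integrable lam01 h" for h :: "real \<Rightarrow> real"
    using that by (rule Bochner_Integration.integrable_bound) (use that in auto)
  have "cdf (unit_density excess) u - cdf (unit_density deficit) u
      = (\<integral>v. of_bool (v \<le> u) * (Q v - G v) \<partial>lam01)"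
    unfolding cdf[OF excess_facts] cdf[OF deficit_facts]
    using int[OF excess_facts(1)] int[OF deficit_facts(1)]
    by (simp flip: Bochner_Integration.integral_diff right_diff_distrib add: excess_minus_deficit)
  also have "\<dots> = (\<integral>v. (Q v - G v) - of_bool (u < v) * (Q v - G v) \<partial>lam01)"
    by (intro Bochner_Integration.integral_cong) auto
  also have "\<dots> = - (\<integral>v. of_bool (u < v) * (Q v - G v) \<partial>lam01)"
    using integrable_Q integrable_G integral_defect
    by (subst Bochner_Integration.integral_diff) (auto intro!: integrable_defect_indicator)
  finally show ?thesis using tail_defect_nonpos[OF u] by simp
qed

section \<open>The pairing of excess and deficit\<close>

abbreviation "Up \<equiv> U_plus \<mu> \<kappa>"
abbreviation "Um \<equiv> U_minus \<mu> \<kappa>"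
abbreviation "Ap \<equiv> A_plus \<mu> \<kappa>"
abbreviation "Am \<equiv> A_minus \<mu> \<kappa>"
abbreviation "\<phi> \<equiv> phi \<mu> \<kappa>"
abbreviation "to_deficit u \<equiv> gen_inv (cdf (unit_density deficit)) (cdf (unit_density excess) u)"
abbreviation "to_excess u \<equiv> gen_inv (cdf (unit_density excess)) (cdf (unit_density deficit) u)"

lemma U_plus_iff: "u \<in> Up \<longleftrightarrow> u \<in> {0<..<1} \<and> 0 < excess u"
  and U_minus_iff: "u \<in> Um \<longleftrightarrow> u \<in> {0<..<1} \<and> 0 < deficit u"
  by (auto simp: U_plus_def U_minus_def excess_def deficit_def)

lemma U_disjoint: "u \<in> Up \<Longrightarrow> u \<notin> Um"
  by (auto simp: U_plus_def U_minus_def)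

lemma phi_eq: "\<phi> u = (if u \<in> Up then to_deficit u else if u \<in> Um then to_excess u else u)"
proof -
  have "gen_inv (Delta_minus \<mu> \<kappa>) w = gen_inv (cdf (unit_density deficit)) w"
    "gen_inv (Delta_plus \<mu> \<kappa>) w = gen_inv (cdf (unit_density excess)) w" for w
    by (intro gen_inv_cong Delta_minus_eq_cdf Delta_plus_eq_cdf; simp)+
  then show ?thesis
    using Delta_plus_eq_cdf[of u] Delta_minus_eq_cdf[of u]
    by (auto simp: phi_def U_plus_def U_minus_def)
qed

lemma sets_lam01_imp_borel: "A \<in> sets lam01 \<Longrightarrow> A \<in> sets borel"
  by (auto simp: sets_lam01 sets_restrict_space)

lemma sets_U [measurable]: "Up \<in> sets lam01" "Um \<in> sets lam01" "Up \<in> sets borel" "Um \<in> sets borel"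
proof -
  have "Up = {u\<in>space lam01. G u < Q u}" "Um = {u\<in>space lam01. Q u < G u}"
    by (auto simp: U_plus_def U_minus_def)
  moreover have "{u\<in>space lam01. G u < Q u} \<in> sets lam01" "{u\<in>space lam01. Q u < G u} \<in> sets lam01"
    by measurable
  ultimately show "Up \<in> sets lam01" "Um \<in> sets lam01" by (simp_all only:)
  then show "Up \<in> sets borel" "Um \<in> sets borel" by (simp_all add: sets_lam01_imp_borel)
qed

lemma measurable_phi [measurable]: "\<phi> \<in> borel_measurable borel"
proof -
  have [measurable]: "to_deficit \<in> borel_measurable borel" "to_excess \<in> borel_measurable borel"
    using measurable_density_rearrangement[OF excess_facts deficit_facts total_excess_eq_deficit]
      measurable_density_rearrangement[OF deficit_facts excess_facts total_excess_eq_deficit[symmetric]]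
    by auto
  show ?thesis unfolding phi_eq[abs_def] by measurable
qed

text \<open>
  If \<open>\<phi> (\<phi> u) = u\<close>, then \<open>pp u\<close> and \<open>pp (\<phi> u)\<close> are the two shares of the sum of the defects at
  \<open>u\<close> and at \<open>\<phi> u\<close>, so they add up to 1.
\<close>

lemma A_plus_iff: "u \<in> Ap \<longleftrightarrow> u \<in> Up \<and> \<phi> u \<in> Um \<and> \<phi> (\<phi> u) = u"
  and A_minus_iff: "u \<in> Am \<longleftrightarrow> u \<in> Um \<and> \<phi> u \<in> Up \<and> \<phi> (\<phi> u) = u"
proof -
  have pp: "pp \<mu> \<kappa> (\<phi> u) = 1 - pp \<mu> \<kappa> u"
    if "\<phi> (\<phi> u) = u" "G (\<phi> u) - Q (\<phi> u) + (Q u - G u) \<noteq> 0" for u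
    using that by (simp add: pp_def field_simps)
  show "u \<in> Ap \<longleftrightarrow> u \<in> Up \<and> \<phi> u \<in> Um \<and> \<phi> (\<phi> u) = u"
    "u \<in> Am \<longleftrightarrow> u \<in> Um \<and> \<phi> u \<in> Up \<and> \<phi> (\<phi> u) = u"
    using pp[of u] by (auto simp: A_plus_def A_minus_def U_plus_def U_minus_def)
qed

lemma sets_A [measurable]: "Ap \<in> sets lam01" "Am \<in> sets lam01"
proof -
  note [measurable] = measurable_ident_lam01
  have "Ap = {u\<in>space lam01. u \<in> Up \<and> \<phi> u \<in> Um \<and> \<phi> (\<phi> u) = u}"
    "Am = {u\<in>space lam01. u \<in> Um \<and> \<phi> u \<in> Up \<and> \<phi> (\<phi> u) = u}"
    by (auto simp: A_plus_iff A_minus_iff U_plus_def U_minus_def)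
  moreover have "{u\<in>space lam01. u \<in> Up \<and> \<phi> u \<in> Um \<and> \<phi> (\<phi> u) = u} \<in> sets lam01"
    "{u\<in>space lam01. u \<in> Um \<and> \<phi> u \<in> Up \<and> \<phi> (\<phi> u) = u} \<in> sets lam01"
    by measurable
  ultimately show "Ap \<in> sets lam01" "Am \<in> sets lam01" by simp_all
qed

lemma phi_A_minus: "v \<in> Am \<Longrightarrow> \<phi> v \<in> Ap \<and> \<phi> (\<phi> v) = v"
  and phi_A_plus: "u \<in> Ap \<Longrightarrow> \<phi> u \<in> Am \<and> \<phi> (\<phi> u) = u"
  by (auto simp: A_plus_iff A_minus_iff)

text \<open>
  The rearrangement carries almost every point of the source to a point where the target density is
  positive and from which the inverse rearrangement returns, which is all that being matched requires.
\<close>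

lemma AE_A: "AE u in lam01. (u \<in> Up \<longrightarrow> u \<in> Ap) \<and> (u \<in> Um \<longrightarrow> u \<in> Am)"
  using AE_density_rearrangement[OF excess_facts deficit_facts total_excess_eq_deficit]
    AE_density_rearrangement[OF deficit_facts excess_facts total_excess_eq_deficit[symmetric]]
proof eventually_elim
  case (elim u)
  have "\<phi> u \<in> Um \<and> \<phi> (\<phi> u) = u" if "u \<in> Up"
  proof -
    have "\<phi> u = to_deficit u" using that by (simp add: phi_eq)
    moreover have "to_deficit u \<in> Um" "to_excess (to_deficit u) = u"
      using that elim(1) by (auto simp: U_plus_iff U_minus_iff)
    moreover have "\<phi> (to_deficit u) = to_excess (to_deficit u)"
      using calculation U_disjoint by (auto simp: phi_eq)
    ultimately show ?thesis by simp
  qed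
  moreover have "\<phi> u \<in> Up \<and> \<phi> (\<phi> u) = u" if "u \<in> Um"
  proof -
    have "\<phi> u = to_excess u" using that U_disjoint by (auto simp: phi_eq)
    moreover have "to_excess u \<in> Up" "to_deficit (to_excess u) = u"
      using that elim(2) by (auto simp: U_plus_iff U_minus_iff)
    moreover have "\<phi> (to_excess u) = to_deficit (to_excess u)"
      using calculation by (auto simp: phi_eq)
    ultimately show ?thesis by simp
  qed
  ultimately show ?case by (simp add: A_plus_iff A_minus_iff)
qed

text \<open>
  The deficit up to \<open>\<phi> u\<close> equals the excess up to \<open>u\<close>, and the excess up to \<open>\<phi> u\<close> is at least that
  large. On \<open>A_plus\<close>, \<open>u\<close> is the least point at which the excess reaches this value.
\<close>

lemma phi_ge_on_A_plus:
  assumes u: "u \<in> Ap"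
  shows "u \<le> \<phi> u"
proof -
  have U: "u \<in> Up" "\<phi> u \<in> Um" "\<phi> (\<phi> u) = u" using u by (auto simp: A_plus_iff)
  have v: "\<phi> u = to_deficit u" using U(1) phi_eq[of u] by simp
  have v2: "to_excess (\<phi> u) = u" "\<phi> u \<in> {0<..<1}"
    using U U_disjoint[of "\<phi> u"] phi_eq[of "\<phi> u"] by (metis, simp add: U_minus_def)
  have "cdf (unit_density deficit) (\<phi> u) = cdf (unit_density excess) u"
    unfolding v using E.cdf_nonneg E.cdf_le_total unit_density_totals
    by (intro D.cdf_gen_inv) auto
  moreover have "cdf (unit_density deficit) (\<phi> u) \<le> cdf (unit_density excess) (\<phi> u)"
    using v2(2) by (rule Delta_minus_le_Delta_plus)
  then have "to_excess (\<phi> u) \<le> \<phi> u"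
    using v2(2) D.cdf_le_total unit_density_totals by (subst E.gen_inv_le_iff) auto
  then show ?thesis using v2(1) by simp
qed

lemma Q_mono_on_A_plus:
  assumes "u \<in> Ap"
  shows "G u < Q u" "Q u \<le> Q (\<phi> u)" "Q (\<phi> u) < G (\<phi> u)" "u \<in> {0<..<1}" "\<phi> u \<in> {0<..<1}"
  using assms phi_ge_on_A_plus[OF assms] mono_onD[OF mono_on_quantile[OF \<mu>], of u "\<phi> u"]
  by (auto simp: A_plus_iff U_plus_def U_minus_def)

end

section \<open>The rearranged kernel\<close>

locale rearranged_coupling = dispersed_coupling +
  fixes \<beta> \<beta>' :: "real \<times> real \<times> real measure \<times> real measure \<Rightarrow> real measure"
  assumes \<beta>: "beta_maps \<beta> \<beta>'"
begin

abbreviation "k u \<equiv> \<kappa> (Q u)"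
abbreviation "m \<equiv> m_kernel \<mu> \<kappa> \<beta> \<beta>'"

abbreviation "matched u \<equiv> (Q u, Q (\<phi> u), k u, k (\<phi> u))"

lemma m_simps:
  "u \<in> Ap \<Longrightarrow> m u = \<beta> (matched u)"
  "u \<in> Ap \<Longrightarrow> m (\<phi> u) = \<beta>' (matched u)"
  "u \<notin> Ap \<Longrightarrow> u \<notin> Am \<Longrightarrow> m u = k u"
proof -
  have disjoint: "v \<in> Am \<Longrightarrow> v \<notin> Ap" for v using U_disjoint by (auto simp: A_plus_iff A_minus_iff)
  show "u \<in> Ap \<Longrightarrow> m u = \<beta> (matched u)" by (simp add: m_kernel_def)
  show "u \<in> Ap \<Longrightarrow> m (\<phi> u) = \<beta>' (matched u)"
    using phi_A_plus[of u] disjoint by (simp add: m_kernel_def)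
  show "u \<notin> Ap \<Longrightarrow> u \<notin> Am \<Longrightarrow> m u = k u" by (simp add: m_kernel_def)
qed

lemma matched_in_frakB: "u \<in> Ap \<Longrightarrow> matched u \<in> frakB"
  using Q_mono_on_A_plus[of u] \<kappa>_P1 by (simp add: frakB_def bary_def)

lemma measurable_kernel_P1_borel [measurable]: "(\<lambda>u. k u) \<in> lam01 \<rightarrow>\<^sub>M P1_borel"
  by (rule measurable_prob_algebra_imp_P1_borel[OF measurable_kernel \<kappa>_P1])

lemma measurable_matched:
  "matched \<in> restrict_space lam01 Ap \<rightarrow>\<^sub>M frakB_algebra"
  unfolding frakB_algebra_def
proof (rule measurable_restrict_space2)
  show "matched \<in> space (restrict_space lam01 Ap) \<rightarrow> frakB"
    using matched_in_frakB by (auto simp: space_restrict_space)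
  have id: "(\<lambda>u. u) \<in> restrict_space lam01 Ap \<rightarrow>\<^sub>M lam01"
    by (intro measurable_restrict_space1 measurable_ident_sets refl)
  have "\<phi> \<in> borel_measurable lam01"
    unfolding measurable_cong_sets[OF sets_lam01 refl] by (rule measurable_restrict_space1) measurable
  then have "\<phi> \<in> restrict_space lam01 Ap \<rightarrow>\<^sub>M restrict_space borel {0<..<1}"
    using Q_mono_on_A_plus(5)
    by (intro measurable_restrict_space2 measurable_restrict_space1) (auto simp: space_restrict_space)
  then have phi: "\<phi> \<in> restrict_space lam01 Ap \<rightarrow>\<^sub>M lam01"
    unfolding measurable_cong_sets[OF refl sets_lam01] .
  show "matched \<in> restrict_space lam01 Ap \<rightarrow>\<^sub>M borel \<Otimes>\<^sub>M borel \<Otimes>\<^sub>M P1_borel \<Otimes>\<^sub>M P1_borel"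
    by (intro measurable_Pair measurable_compose[OF id measurable_Q] measurable_compose[OF phi measurable_Q]
        measurable_compose[OF id measurable_kernel_P1_borel]
        measurable_compose[OF phi measurable_kernel_P1_borel])
qed

lemma measurable_m_P1_borel: "m \<in> lam01 \<rightarrow>\<^sub>M P1_borel"
proof -
  have \<beta>_meas: "\<beta> \<in> frakB_algebra \<rightarrow>\<^sub>M P1_borel" "\<beta>' \<in> frakB_algebra \<rightarrow>\<^sub>M P1_borel"
    using \<beta> by (auto simp: beta_maps_def)
  have "\<phi> \<in> borel_measurable lam01"
    unfolding measurable_cong_sets[OF sets_lam01 refl] by (rule measurable_restrict_space1) measurable
  then have "\<phi> \<in> restrict_space lam01 Am \<rightarrow>\<^sub>M restrict_space borel {0<..<1}"
    using phi_A_minus Q_mono_on_A_plus(4)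
    by (intro measurable_restrict_space2 measurable_restrict_space1) (fastforce simp: space_restrict_space)+
  then have "\<phi> \<in> restrict_space lam01 Am \<rightarrow>\<^sub>M lam01"
    unfolding measurable_cong_sets[OF refl sets_lam01] .
  then have phi: "\<phi> \<in> restrict_space lam01 Am \<rightarrow>\<^sub>M restrict_space lam01 Ap"
    using phi_A_minus by (intro measurable_restrict_space2) (auto simp: space_restrict_space)
  have plus: "(\<lambda>u. \<beta> (matched u)) \<in> restrict_space lam01 Ap \<rightarrow>\<^sub>M P1_borel"
    by (rule measurable_compose[OF measurable_matched \<beta>_meas(1)])
  have minus: "(\<lambda>u. \<beta>' (matched (\<phi> u))) \<in> restrict_space lam01 Am \<rightarrow>\<^sub>M P1_borel"
    by (rule measurable_compose[OF measurable_compose[OF phi measurable_matched] \<beta>_meas(2)])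
  have sets_space: "{u\<in>space lam01. u \<in> Ap} \<in> sets lam01" "{u\<in>space lam01. u \<in> Am} \<in> sets lam01"
    by measurable
  have restrict_A: "restrict_space lam01 {u. u \<in> Ap} = restrict_space lam01 Ap"
    "restrict_space lam01 {u. u \<in> Am} = restrict_space lam01 Am" by simp_all
  \<comment> \<open>\<open>\<beta>\<close> and \<open>\<beta>'\<close> are measurable on \<^const>\<open>frakB\<close> only, so each case is treated on its own subspace.\<close>
  define m' where "m' u = (if u \<in> Am then \<beta>' (matched (\<phi> u)) else k u)" for u
  have "m' \<in> lam01 \<rightarrow>\<^sub>M P1_borel"
    unfolding m'_def measurable_If_restrict_space_iff[OF sets_space(2)]
    using minus by (simp add: restrict_A measurable_restrict_space1[OF measurable_kernel_P1_borel])
  then have "(\<lambda>u. if u \<in> Ap then \<beta> (matched u) else m' u) \<in> lam01 \<rightarrow>\<^sub>M P1_borel"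
    unfolding measurable_If_restrict_space_iff[OF sets_space(1)]
    using plus by (simp add: restrict_A measurable_restrict_space1)
  moreover have "m = (\<lambda>u. if u \<in> Ap then \<beta> (matched u) else m' u)"
  proof
    fix u
    have "m u = \<beta>' (matched (\<phi> u))" if "u \<in> Am"
      using m_simps(2)[of "\<phi> u"] phi_A_minus[OF that] by simp
    then show "m u = (if u \<in> Ap then \<beta> (matched u) else m' u)"
      by (cases "u \<in> Ap"; cases "u \<in> Am") (simp_all add: m'_def m_simps(1,3))
  qed
  ultimately show ?thesis by (simp only:)
qed

lemma measurable_m [measurable]: "m \<in> lam01 \<rightarrow>\<^sub>M prob_algebra borel"
  by (rule measurable_P1_borel_imp_prob_algebra[OF measurable_m_P1_borel])

lemma m_P1: "u \<in> {0<..<1} \<Longrightarrow> m u \<in> P1"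
  using measurable_space[OF measurable_m_P1_borel, of u] by (simp add: space_P1_borel)

lemma m_on_A_plus:
  assumes u: "u \<in> Ap"
  shows "mean (m u) = Q u" "mean (m (\<phi> u)) = Q (\<phi> u)"
    and "st_le (k u) (m u)" "st_le (m (\<phi> u)) (k (\<phi> u))"
    and "B \<in> sets borel \<Longrightarrow> deficit (\<phi> u) * (measure (m u) B - measure (k u) B)
           + excess u * (measure (m (\<phi> u)) B - measure (k (\<phi> u)) B) = 0"
proof -
  let ?q = "(G (\<phi> u) - Q (\<phi> u)) / (Q u - G u + G (\<phi> u) - Q (\<phi> u))"
  from bspec[OF conjunct2[OF conjunct2[OF \<beta>[unfolded beta_maps_def]]] matched_in_frakB[OF u]] have props:
    "mean (m u) = Q u \<and> mean (m (\<phi> u)) = Q (\<phi> u) \<and> st_le (k u) (m u) \<and> st_le (m (\<phi> u)) (k (\<phi> u)) \<and>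
     (\<forall>A\<in>sets borel. ?q * measure (m u) A + (1 - ?q) * measure (m (\<phi> u)) A
                          = ?q * measure (k u) A + (1 - ?q) * measure (k (\<phi> u)) A)"
    unfolding m_simps(1)[OF u] m_simps(2)[OF u] case_prod_conv Let_def bary_def .
  then show "mean (m u) = Q u" "mean (m (\<phi> u)) = Q (\<phi> u)"
    "st_le (k u) (m u)" "st_le (m (\<phi> u)) (k (\<phi> u))" by blast+
  assume "B \<in> sets borel"
  with props have "?q * measure (m u) B + (1 - ?q) * measure (m (\<phi> u)) B
      = ?q * measure (k u) B + (1 - ?q) * measure (k (\<phi> u)) B" by blast
  then have mix: "?q * (measure (m u) B - measure (k u) B)
      + (1 - ?q) * (measure (m (\<phi> u)) B - measure (k (\<phi> u)) B) = 0"
    unfolding right_diff_distrib by linarith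
  note G = Q_mono_on_A_plus(1,3)[OF u]
  have d: "deficit (\<phi> u) = G (\<phi> u) - Q (\<phi> u)" and e: "excess u = Q u - G u"
    using G by (simp_all add: deficit_def excess_def)
  have s: "Q u - G u + G (\<phi> u) - Q (\<phi> u) = excess u + deficit (\<phi> u)" using d e by simp
  have pos: "excess u + deficit (\<phi> u) > 0" using G d e by simp
  have q: "?q = deficit (\<phi> u) / (excess u + deficit (\<phi> u))" by (simp add: s flip: d)
  have q': "1 - ?q = excess u / (excess u + deficit (\<phi> u))"
    unfolding q using pos by (simp add: field_simps)
  show "deficit (\<phi> u) * (measure (m u) B - measure (k u) B)
      + excess u * (measure (m (\<phi> u)) B - measure (k (\<phi> u)) B) = 0"
    using mix pos unfolding q' unfolding q times_divide_eq_left add_divide_distrib[symmetric] divide_eq_0_iff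
    by (metis less_irrefl)
qed

lemma AE_matched_or_balanced:
  "AE u in lam01. u \<in> Ap \<or> (u \<in> Am \<and> \<phi> u \<in> Ap \<and> \<phi> (\<phi> u) = u) \<or> (u \<notin> Ap \<and> u \<notin> Am \<and> Q u = G u)"
  using AE_A AE_space
proof eventually_elim
  case (elim u)
  have "u \<in> Up \<or> u \<in> Um \<or> Q u = G u" using elim(2) by (auto simp: U_plus_def U_minus_def)
  moreover have "u \<notin> Ap \<and> u \<notin> Am" if "Q u = G u"
    using that by (auto simp: A_plus_iff A_minus_iff U_plus_def U_minus_def)
  ultimately show ?case using elim(1) phi_A_minus[of u] by blast
qed

lemma AE_m_martingale: "AE u in lam01. integrable (m u) (\<lambda>y. y) \<and> mean (m u) = Q u"
  using AE_matched_or_balanced AE_space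
proof eventually_elim
  case (elim u)
  have "mean (m u) = Q u"
    using elim(1) m_on_A_plus(1)[of u] m_on_A_plus(2)[of "\<phi> u"] m_simps(3)[of u] by (auto simp: bary_def)
  then show ?case using P1_D(4)[OF m_P1, of u] elim(2) by simp
qed

lemma AE_W1_m: "AE u in lam01. W1 (k u) (m u) = ennreal \<bar>G u - Q u\<bar>"
  using AE_matched_or_balanced AE_m_martingale AE_space
proof eventually_elim
  case (elim u)
  have "st_le (k u) (m u) \<or> st_le (m u) (k u)"
    using elim(1) m_on_A_plus(3)[of u] m_on_A_plus(4)[of "\<phi> u"] m_simps(3)[of u]
    by (auto simp: st_le_def)
  then show ?case
    using W1_eq_mean_diff[OF \<kappa>_P1 m_P1, of u "Q u"] elim(2,3) by (simp add: bary_def)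
qed

text \<open>
  The change of mass at matched points satisfies \<open>D\<^sub>u / excess u = - D\<^bsub>\<phi>(u)\<^esub> / deficit (\<phi> u)\<close>.
  Since \<open>\<phi>\<close> transports the measure with density \<open>excess\<close> to the one with density \<open>deficit\<close>, the
  total changes over \<open>A_plus\<close> and over \<open>A_minus\<close> cancel.
\<close>

lemma integral_mass_change:
  assumes B: "B \<in> sets borel"
  shows "(\<integral>u. measure (m u) B - measure (k u) B \<partial>lam01) = 0"
proof -
  define D where "D u = measure (m u) B - measure (k u) B" for u
  have [measurable]: "(\<lambda>u. measure (m u) B) \<in> borel_measurable lam01"
    "(\<lambda>u. measure (k u) B) \<in> borel_measurable lam01"
    using measurable_compose[OF measurable_prob_algebraD[OF measurable_m] measurable_measure_subprob_algebra[OF B]]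
      measurable_compose[OF measurable_prob_algebraD[OF measurable_kernel] measurable_measure_subprob_algebra[OF B]]
    by simp_all
  then have D_meas [measurable]: "D \<in> borel_measurable lam01" unfolding D_def by measurable
  have D_bound: "\<bar>D u\<bar> \<le> 1" if "u \<in> {0<..<1}" for u
    using prob_space.prob_le_1[OF kernel_D(1)[OF measurable_m that], of B]
      prob_space.prob_le_1[OF kernel_D(1)[OF measurable_kernel that], of B]
      measure_nonneg[of "m u" B] measure_nonneg[of "k u" B]
    unfolding D_def by linarith
  have int: "integrable lam01 (\<lambda>u. indicator S u * D u)" if [measurable]: "S \<in> sets lam01" for S
    by (rule lam01.integrable_const_bound[of _ 1])
      (use D_bound in \<open>auto intro!: AE_I2 split: split_indicator\<close>)
  let ?h = "\<lambda>v. indicator Am v * D v / deficit v"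
  have [measurable]: "deficit \<in> borel_measurable lam01" "excess \<in> borel_measurable lam01"
    using excess_facts(1) deficit_facts(1) by auto
  have h_meas: "?h \<in> borel_measurable lam01" by measurable
  have "(\<integral>v. indicator Am v * D v \<partial>lam01) = (\<integral>v. deficit v * ?h v \<partial>lam01)"
    by (intro Bochner_Integration.integral_cong) (auto simp: A_minus_iff U_minus_iff split: split_indicator)
  also have "\<dots> = (\<integral>u. excess u * (indicator {0<..<1} (to_deficit u) * ?h (to_deficit u)) \<partial>lam01)"
    by (rule integral_density_rearrangement[OF excess_facts deficit_facts total_excess_eq_deficit h_meas])
  also have "\<dots> = (\<integral>u. - (indicator Ap u * D u) \<partial>lam01)"
  proof (rule integral_cong_AE)
    show "AE u in lam01. excess u * (indicator {0<..<1} (to_deficit u) * ?h (to_deficit u))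
        = - (indicator Ap u * D u)"
      using AE_A AE_space
    proof eventually_elim
      case (elim u)
      show ?case
      proof (cases "u \<in> Ap")
        case True
        then have phi: "\<phi> u = to_deficit u" using phi_eq[of u] by (simp add: A_plus_iff)
        have v: "\<phi> u \<in> Am" "\<phi> u \<in> {0<..<1}" "deficit (\<phi> u) > 0"
          using phi_A_plus[OF True] by (auto simp: A_minus_iff U_minus_iff)
        have "deficit (\<phi> u) * D u + excess u * D (\<phi> u) = 0"
          using m_on_A_plus(5)[OF True B] by (simp add: D_def)
        then have "excess u * (D (\<phi> u) / deficit (\<phi> u)) = - D u"
          using v(3) by (simp add: field_simps)
        then show ?thesis using v True unfolding phi[symmetric] by simp
      next
        case False
        then have "u \<notin> Up" using elim(1) by blast
        then have "excess u = 0"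
          using elim(2) excess_facts(2) by (auto simp: U_plus_iff not_less intro: antisym)
        then show ?thesis using False by simp
      qed
    qed
    have k: "(\<lambda>x. indicator {0<..<1} x * ?h x) \<in> borel_measurable borel"
      by (rule iffD1[OF measurable_lam01_iff h_meas])
    have "(\<lambda>u. indicator {0<..<1} (to_deficit u) * ?h (to_deficit u)) \<in> borel_measurable borel"
      by (rule measurable_compose[OF measurable_density_rearrangement[OF excess_facts deficit_facts
            total_excess_eq_deficit] k])
    then have "(\<lambda>u. indicator {0<..<1} (to_deficit u) * ?h (to_deficit u)) \<in> borel_measurable lam01"
      unfolding measurable_cong_sets[OF sets_lam01 refl] by (rule measurable_restrict_space1)
    then show "(\<lambda>u. excess u * (indicator {0<..<1} (to_deficit u) * ?h (to_deficit u)))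
        \<in> borel_measurable lam01" by measurable
  qed measurable
  finally have cancel: "(\<integral>v. indicator Am v * D v \<partial>lam01) = - (\<integral>u. indicator Ap u * D u \<partial>lam01)"
    by (simp del: Bochner_Integration.integral_mult_right_zero)
  have "(\<integral>u. D u \<partial>lam01) = (\<integral>u. indicator Ap u * D u + indicator Am u * D u \<partial>lam01)"
  proof (intro Bochner_Integration.integral_cong refl)
    fix u
    show "D u = indicator Ap u * D u + indicator Am u * D u"
      using U_disjoint[of u] m_simps(3)[of u]
      by (auto simp: D_def A_plus_iff A_minus_iff split: split_indicator)
  qed
  also have "\<dots> = 0"
    using int[OF sets_A(1)] int[OF sets_A(2)] cancel by simp
  finally show ?thesis by (simp add: D_def)
qed

lemma m_marginal: "lam01 \<bind> m = \<nu>"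
proof -
  have "lam01 \<bind> m = lam01 \<bind> k"
  proof (rule measure_eqI)
    show "sets (lam01 \<bind> m) = sets (lam01 \<bind> k)"
      using sets_bind_measurable[OF measurable_prob_algebraD[OF measurable_m]]
        sets_bind_measurable[OF measurable_prob_algebraD[OF measurable_kernel]] by simp
    fix B assume "B \<in> sets (lam01 \<bind> m)"
    then have B: "B \<in> sets borel"
      using sets_bind_measurable[OF measurable_prob_algebraD[OF measurable_m]] by simp
    have int: "integrable lam01 (\<lambda>u. measure (p u) B)"
      and eq: "emeasure (lam01 \<bind> p) B = ennreal (\<integral>u. measure (p u) B \<partial>lam01)"
      if p: "p \<in> lam01 \<rightarrow>\<^sub>M prob_algebra borel" for p
    proof -
      have "(\<lambda>u. measure (p u) B) \<in> borel_measurable lam01"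
        by (rule measurable_compose[OF measurable_prob_algebraD[OF p] measurable_measure_subprob_algebra[OF B]])
      then show int: "integrable lam01 (\<lambda>u. measure (p u) B)"
        using prob_space.prob_le_1[OF kernel_D(1)[OF p]]
        by (intro lam01.integrable_const_bound[of _ 1]) (auto intro!: AE_I2)
      have "emeasure (lam01 \<bind> p) B = (\<integral>\<^sup>+u. emeasure (p u) B \<partial>lam01)"
        using B by (intro emeasure_bind[OF _ measurable_prob_algebraD[OF p]]) auto
      also have "\<dots> = (\<integral>\<^sup>+u. ennreal (measure (p u) B) \<partial>lam01)"
        using kernel_D(1)[OF p]
        by (intro nn_integral_cong finite_measure.emeasure_eq_measure) (auto simp: prob_space_def)
      also have "\<dots> = ennreal (\<integral>u. measure (p u) B \<partial>lam01)"
        using int by (intro nn_integral_eq_integral) auto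
      finally show "emeasure (lam01 \<bind> p) B = ennreal (\<integral>u. measure (p u) B \<partial>lam01)" .
    qed
    show "emeasure (lam01 \<bind> m) B = emeasure (lam01 \<bind> k) B"
      using integral_mass_change[OF B] int[OF measurable_m] int[OF measurable_kernel]
      unfolding eq[OF measurable_m] eq[OF measurable_kernel] by simp
  qed
  then show ?thesis by (simp add: kernel_marginal)
qed

lemma iota_lifted: "iota \<mu> \<kappa> \<in> lifted_couplings \<mu> \<nu>"
  unfolding iota_def lifted_couplings_def
  using third_marginal_lift[OF \<mu> measurable_kernel] kernel_marginal measurable_kernel by blast

lemma lift_m_martingale: "lift \<mu> m \<in> lifted_martingale_couplings \<mu> \<nu>"
  unfolding lifted_martingale_couplings_def
  using third_marginal_lift[OF \<mu> measurable_m] m_marginal measurable_m AE_m_martingale by blast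

lemma AW1_lower_bound:
  assumes "M' \<in> lifted_martingale_couplings \<mu> \<nu>"
  shows "(\<integral>\<^sup>+u. ennreal \<bar>G u - Q u\<bar> \<partial>lam01) \<le> AW1 \<mu> \<mu> (iota \<mu> \<kappa>) M'"
proof -
  obtain p where p: "M' = lift \<mu> p" "p \<in> lam01 \<rightarrow>\<^sub>M prob_algebra borel"
    "AE u in lam01. integrable (p u) (\<lambda>y. y) \<and> mean (p u) = Q u"
    using assms unfolding lifted_martingale_couplings_def by blast
  show ?thesis
    using AW1_ge_barycentre_defect[OF \<mu> measurable_kernel p(2) \<kappa>_P1 p(3)]
    by (simp add: p(1) iota_def bary_def)
qed

lemma W1_integral_eq_defect:
  "(\<integral>\<^sup>+u. W1 (k u) (m u) \<partial>lam01) = (\<integral>\<^sup>+u. ennreal \<bar>G u - Q u\<bar> \<partial>lam01)"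
  by (rule nn_integral_cong_AE[OF AE_W1_m])

lemma AW1_m_eq_defect: "AW1 \<mu> \<mu> (iota \<mu> \<kappa>) (lift \<mu> m) = (\<integral>\<^sup>+u. ennreal \<bar>G u - Q u\<bar> \<partial>lam01)"
proof (rule antisym)
  show "AW1 \<mu> \<mu> (iota \<mu> \<kappa>) (lift \<mu> m) \<le> (\<integral>\<^sup>+u. ennreal \<bar>G u - Q u\<bar> \<partial>lam01)"
    using AW1_le_diagonal[OF \<mu> measurable_kernel measurable_m] by (simp add: iota_def W1_integral_eq_defect)
qed (rule AW1_lower_bound[OF lift_m_martingale])

end

theorem proposition2p5:
  fixes \<mu> \<nu> :: "real measure"
    and \<pi> :: "(real \<times> real) measure"
    and \<kappa> :: "real \<Rightarrow> real measure"
    and \<beta> \<beta>' :: "real \<times> real \<times> real measure \<times> real measure \<Rightarrow> real measure"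
    and Mhat :: "(real \<times> real \<times> real) measure"
  assumes "\<mu> \<in> P1" and "\<nu> \<in> P1"
    and "cx_le \<mu> \<nu>" and "\<mu> \<noteq> \<nu>"
    and "\<pi> \<in> couplings \<mu> \<nu>"
    and "disintegration \<mu> \<pi> \<kappa>"
    and "barycentre_dispersion \<mu> \<kappa>"
    and "beta_maps \<beta> \<beta>'"
    and "Mhat = lift \<mu> (m_kernel \<mu> \<kappa> \<beta> \<beta>')"
  shows "lifted_martingale_rearrangement \<mu> \<nu> (iota \<mu> \<kappa>) Mhat
    \<and> Mhat \<in> lifted_martingale_couplings \<mu> \<nu>
    \<and> (INF M'\<in>lifted_martingale_couplings \<mu> \<nu>. AW1 \<mu> \<mu> (iota \<mu> \<kappa>) M') = AW1 \<mu> \<mu> (iota \<mu> \<kappa>) Mhat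
    \<and> AW1 \<mu> \<mu> (iota \<mu> \<kappa>) Mhat = (\<integral>\<^sup>+u. W1 (\<kappa> (quantile \<mu> u)) (m_kernel \<mu> \<kappa> \<beta> \<beta>' u) \<partial>lam01)
    \<and> (\<integral>\<^sup>+u. W1 (\<kappa> (quantile \<mu> u)) (m_kernel \<mu> \<kappa> \<beta> \<beta>' u) \<partial>lam01)
        = (\<integral>\<^sup>+u. ennreal \<bar>bary \<mu> \<kappa> u - quantile \<mu> u\<bar> \<partial>lam01)"
proof -
  interpret rearranged_coupling \<mu> \<nu> \<kappa> \<beta> \<beta>'
  proof
    show "\<kappa> \<in> borel \<rightarrow>\<^sub>M prob_algebra borel" "\<kappa> x \<in> P1" for x
      using assms(6) by (auto simp: disintegration_def)
    show "\<mu> \<bind> \<kappa> = \<nu>"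
      by (rule second_marginal_disintegration) fact+
    show "mean \<mu> = mean \<nu>"
      by (rule cx_le_imp_mean_eq) fact+
  qed fact+
  have "(INF M'\<in>lifted_martingale_couplings \<mu> \<nu>. AW1 \<mu> \<mu> (iota \<mu> \<kappa>) M') = AW1 \<mu> \<mu> (iota \<mu> \<kappa>) Mhat"
  proof (rule antisym)
    show "AW1 \<mu> \<mu> (iota \<mu> \<kappa>) Mhat \<le> (INF M'\<in>lifted_martingale_couplings \<mu> \<nu>. AW1 \<mu> \<mu> (iota \<mu> \<kappa>) M')"
      unfolding assms(9) AW1_m_eq_defect by (intro INF_greatest AW1_lower_bound)
  qed (unfold assms(9), rule INF_lower[OF lift_m_martingale])
  then show ?thesis
    using iota_lifted lift_m_martingale
    by (simp add: lifted_martingale_rearrangement_def assms(9) AW1_m_eq_defect W1_integral_eq_defect)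
qed

end
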